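(* If $G$ is an outerplanar graph, then $\mathrm{HG}(G)\le 40$.
   Context: A graph is outerplanar if it can be drawn in the plane without crossings such that all vertices lie on the boundary of the unbounded region. Hat guessing game: players sit on the vertices of a graph $G$; a strategy with $q$ colours is a family $(f_v)_{v\in V(G)}$ with $f_v\colon [q]^{N_G(v)}\to[q]$. An adversary chooses a colouring $c\colon V(G)\to[q]$; the strategy is winning if for every $c$ there is a vertex $v$ with $f_v((c(w))_{w\in N_G(v)})=c(v)$. $\mathrm{HG}(G)$ is the largest $q$ for which a winning strategy with $q$ colours exists. *)

theory Defs
  imports "HOL-Analysis.Analysis"
begin

definition simple_graph :: "'a set \<Rightarrow> ('a \<Rightarrow> 'a \<Rightarrow> bool) \<Rightarrow> bool" where
  "simple_graph V E \<longleftrightarrow> finite V \<and> (\<forall>u v. E u v \<longrightarrow> u \<in> V \<and> v \<in> V)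
     \<and> (\<forall>u v. E u v \<longrightarrow> E v u) \<and> (\<forall>v. \<not> E v v)"

definition plane_drawing ::
  "'a set \<Rightarrow> ('a \<Rightarrow> 'a \<Rightarrow> bool) \<Rightarrow> ('a \<Rightarrow> complex) \<Rightarrow> ('a \<Rightarrow> 'a \<Rightarrow> real \<Rightarrow> complex) \<Rightarrow> bool" where
  "plane_drawing V E pos crv \<longleftrightarrow>
     inj_on pos V \<and>
     (\<forall>u v. E u v \<longrightarrow> arc (crv u v) \<and> pathstart (crv u v) = pos u \<and> pathfinish (crv u v) = pos v
        \<and> path_image (crv v u) = path_image (crv u v)) \<and>
     (\<forall>u v w. E u v \<and> w \<in> V \<and> pos w \<in> path_image (crv u v) \<longrightarrow> w = u \<or> w = v) \<and>
     (\<forall>u v x y. E u v \<and> E x y \<and> {u, v} \<noteq> {x, y} \<longrightarrow>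
        path_image (crv u v) \<inter> path_image (crv x y) \<subseteq> pos ` ({u, v} \<inter> {x, y}))"

definition drawing_set ::
  "'a set \<Rightarrow> ('a \<Rightarrow> 'a \<Rightarrow> bool) \<Rightarrow> ('a \<Rightarrow> complex) \<Rightarrow> ('a \<Rightarrow> 'a \<Rightarrow> real \<Rightarrow> complex) \<Rightarrow> complex set" where
  "drawing_set V E pos crv = pos ` V \<union> (\<Union>{path_image (crv u v) | u v. E u v})"

definition outerplanar :: "'a set \<Rightarrow> ('a \<Rightarrow> 'a \<Rightarrow> bool) \<Rightarrow> bool" where
  "outerplanar V E \<longleftrightarrow> simple_graph V E \<and>
     (\<exists>pos crv U z. plane_drawing V E pos crv \<and>
        z \<notin> drawing_set V E pos crv \<and>
        U = connected_component_set (- drawing_set V E pos crv) z \<and>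
        \<not> bounded U \<and> (\<forall>v\<in>V. pos v \<in> frontier U))"

definition hat_strategy :: "('a \<Rightarrow> 'a \<Rightarrow> bool) \<Rightarrow> nat \<Rightarrow> ('a \<Rightarrow> ('a \<Rightarrow> nat) \<Rightarrow> nat) \<Rightarrow> bool" where
  "hat_strategy E q f \<longleftrightarrow>
     (\<forall>v c c'. (\<forall>w. E v w \<longrightarrow> c w = c' w) \<longrightarrow> f v c = f v c') \<and>
     (\<forall>v c. f v c < q)"

definition hat_winning :: "'a set \<Rightarrow> ('a \<Rightarrow> 'a \<Rightarrow> bool) \<Rightarrow> nat \<Rightarrow> bool" where
  "hat_winning V E q \<longleftrightarrow> (\<exists>f. hat_strategy E q f \<and>
     (\<forall>c. (\<forall>v\<in>V. c v < q) \<longrightarrow> (\<exists>v\<in>V. f v c = c v)))"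

end

theory Submission
  imports Defs "HOL-Library.Tree" "HOL-Library.Sublist"
begin

text \<open>
  Let each vertex \<open>v\<close> make up to \<open>g v\<close> guesses, and let the adversary commit to the colour of \<open>v\<close> only
  after all other vertices are coloured. A neighbour's colour is then dangerous only if it is guessed
  for many colours of \<open>v\<close>, and double counting bounds the number of dangerous colours. With \<open>q \<ge> 41\<close>
  colours this lets us delete a vertex with at most 4 guesses and at most two remaining neighbours, at
  the price of doubling the guesses of one neighbour (from 1 to 2 or from 2 to 4) while the other one,
  if it makes a single guess, is unaffected.

  An outerplanar drawing gives an order of the vertices in which no two edges cross: a theta curve
  has an arc inside the circle formed by the other two, so there are no three internally disjoint
  paths of length at least two with the same ends, and no cycle has crossing chords; hence
  2-connected pieces are Hamiltonian. The graph is thus part of a triangulated polygon, in which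
  the deletions can be arranged so that every vertex is doubled at most twice.
\<close>

section \<open>Deleting a vertex from the guessing game\<close>

text \<open>Sets of guesses replace single guesses because deletions enlarge them. Visibility is cut
  down to \<open>W\<close>, so the game lives on the induced subgraph; colourings stay total, so
  that a deleted vertex can be coloured later by a function update.\<close>

definition adversary_wins :: "('a \<Rightarrow> 'a \<Rightarrow> bool) \<Rightarrow> nat \<Rightarrow> 'a set \<Rightarrow> ('a \<Rightarrow> nat) \<Rightarrow> bool" where
  "adversary_wins E q W g \<longleftrightarrow>
     (\<forall>F. (\<forall>v\<in>W. \<forall>c. F v c \<subseteq> {..<q} \<and> card (F v c) \<le> g v) \<longrightarrow>
          (\<forall>v\<in>W. \<forall>c c'. (\<forall>w\<in>W. E v w \<longrightarrow> c w = c' w) \<longrightarrow> F v c = F v c') \<longrightarrow>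
          (\<exists>c. (\<forall>v. c v < q) \<and> (\<forall>v\<in>W. c v \<notin> F v c)))"

lemma adversary_winsD:
  assumes "adversary_wins E q W g"
    and "\<And>v c. v \<in> W \<Longrightarrow> F v c \<subseteq> {..<q} \<and> card (F v c) \<le> g v"
    and "\<And>v c c'. v \<in> W \<Longrightarrow> \<forall>w\<in>W. E v w \<longrightarrow> c w = c' w \<Longrightarrow> F v c = F v c'"
  obtains c where "\<And>v. c v < q" "\<And>v. v \<in> W \<Longrightarrow> c v \<notin> F v c"
proof -
  have "\<exists>c. (\<forall>v. c v < q) \<and> (\<forall>v\<in>W. c v \<notin> F v c)"
    by (rule assms(1)[unfolded adversary_wins_def, THEN spec, THEN mp, THEN mp]) (use assms(2,3) in auto)
  then show ?thesis using that by blast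
qed

lemma adversary_wins_empty: "q > 0 \<Longrightarrow> adversary_wins E q {} g"
  by (auto simp: adversary_wins_def)

lemma adversary_wins_mono:
  fixes W :: "'a set"
  assumes "adversary_wins E q W g" "\<And>v. v \<in> W \<Longrightarrow> g' v \<le> g v"
  shows "adversary_wins E q W g'"
  unfolding adversary_wins_def
proof (intro allI impI)
  fix F :: "'a \<Rightarrow> ('a \<Rightarrow> nat) \<Rightarrow> nat set"
  assume "\<forall>v\<in>W. \<forall>c. F v c \<subseteq> {..<q} \<and> card (F v c) \<le> g' v"
    and loc: "\<forall>v\<in>W. \<forall>c c'. (\<forall>w\<in>W. E v w \<longrightarrow> c w = c' w) \<longrightarrow> F v c = F v c'"
  then have "\<forall>v\<in>W. \<forall>c. F v c \<subseteq> {..<q} \<and> card (F v c) \<le> g v"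
    using assms(2) by (meson order_trans)
  with loc show "\<exists>c. (\<forall>v. c v < q) \<and> (\<forall>v\<in>W. c v \<notin> F v c)"
    using assms(1) unfolding adversary_wins_def by blast
qed

text \<open>Double counting of the pairs with \<open>\<alpha> \<in> S \<gamma>\<close>. In the
  application \<open>\<gamma>\<close> is the colour of a vertex to be deleted and
  \<open>S \<gamma>\<close> the guesses that a neighbour then makes.\<close>

lemma card_frequent_le:
  fixes q k t :: nat and S :: "nat \<Rightarrow> nat set"
  assumes "\<And>\<gamma>. \<gamma> < q \<Longrightarrow> S \<gamma> \<subseteq> {..<q} \<and> card (S \<gamma>) \<le> k"
  shows "card {\<alpha>. \<alpha> < q \<and> t \<le> card {\<gamma>. \<gamma> < q \<and> \<alpha> \<in> S \<gamma>}} * t \<le> q * k"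
proof -
  let ?n = "\<lambda>\<alpha>. card {\<gamma>. \<gamma> < q \<and> \<alpha> \<in> S \<gamma>}" and ?A = "{\<alpha>. \<alpha> < q \<and> t \<le> card {\<gamma>. \<gamma> < q \<and> \<alpha> \<in> S \<gamma>}}"
  have "card ?A * t = (\<Sum>\<alpha>\<in>?A. t)" by simp
  also have "\<dots> \<le> (\<Sum>\<alpha>\<in>?A. ?n \<alpha>)" by (rule sum_mono) simp
  also have "\<dots> \<le> (\<Sum>\<alpha><q. ?n \<alpha>)" by (rule sum_mono2) auto
  also have "\<dots> = (\<Sum>\<alpha>\<in>{..<q}. \<Sum>\<gamma>\<in>{..<q}. if \<alpha> \<in> S \<gamma> then 1 else 0)"
    by (intro sum.cong refl) (simp add: sum.If_cases Int_def)
  also have "\<dots> = (\<Sum>\<gamma>\<in>{..<q}. \<Sum>\<alpha>\<in>{..<q}. if \<alpha> \<in> S \<gamma> then 1 else 0)" by (rule sum.swap)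
  also have "\<dots> = (\<Sum>\<gamma><q. card (S \<gamma>))"
  proof (intro sum.cong refl)
    fix \<gamma> assume "\<gamma> \<in> {..<q}"
    then have "S \<gamma> \<subseteq> {..<q}" using assms by blast
    then have "{..<q} \<inter> {\<alpha>. \<alpha> \<in> S \<gamma>} = S \<gamma>" by auto
    then show "(\<Sum>\<alpha>\<in>{..<q}. if \<alpha> \<in> S \<gamma> then 1 else 0) = card (S \<gamma>)"
      by (simp add: sum.If_cases)
  qed
  also have "\<dots> \<le> (\<Sum>\<gamma><q. k)" using assms by (intro sum_mono) auto
  finally show ?thesis by simp
qed

text \<open>After the deletion, \<open>a\<close> and \<open>b\<close> guess the colours that they
  would guess for at least \<open>t1\<close>, respectively \<open>t2\<close>, colours of
  \<open>v\<close>. If the adversary avoids these, each of the two excludes few colours of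
  \<open>v\<close>, and one is left over. Either of \<open>a\<close> and \<open>b\<close> may lie
  outside \<open>W\<close> or equal \<open>v\<close>, which covers vertices with fewer
  neighbours.\<close>

lemma adversary_wins_eliminate:
  fixes W :: "'a set"
  assumes q: "q \<ge> 41" and v: "v \<in> W" "\<not> E v v" "g v \<le> 4"
    and nb: "\<And>w. w \<in> W \<Longrightarrow> E w v \<Longrightarrow> w = a \<or> w = b"
    and r: "a \<noteq> b" "g a = 1" "g b \<le> 2"
    and win: "adversary_wins E q (W - {v}) (g(b := 2 * g b))"
  shows "adversary_wins E q W g"
  unfolding adversary_wins_def
proof (intro allI impI)
  fix F :: "'a \<Rightarrow> ('a \<Rightarrow> nat) \<Rightarrow> nat set"
  assume bnd: "\<forall>v\<in>W. \<forall>c. F v c \<subseteq> {..<q} \<and> card (F v c) \<le> g v"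
    and loc: "\<forall>v\<in>W. \<forall>c c'. (\<forall>w\<in>W. E v w \<longrightarrow> c w = c' w) \<longrightarrow> F v c = F v c'"
  \<comment> \<open>As \<open>t1\<close> exceeds half of \<open>q\<close>, at most one colour of
    \<open>a\<close> is dangerous; \<open>5 * t2 > 2 * q\<close> leaves at most
    \<open>2 * g b\<close> for \<open>b\<close>. At most
    \<open>(t1 - 1) + (t2 - 1) + 4 = q - 1\<close> colours of \<open>v\<close> are excluded. The
    inequality for \<open>t2\<close> holds from 41 on and fails at \<open>q = 40\<close>.\<close>
  define t1 where "t1 = q div 2 + 1"
  define t2 where "t2 = (q + 1) div 2 - 4"
  define often where "often r c t = {\<alpha>. \<alpha> < q \<and> t \<le> card {\<gamma>. \<gamma> < q \<and> \<alpha> \<in> F r (c(v := \<gamma>))}}" for r c t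
  define F' where "F' r c = (if r = a then often r c t1 else if r = b then often r c t2 else F r c)" for r c
  have often: "card (often r c t) * t \<le> q * g r" if "r \<in> W" for r c t
    unfolding often_def using bnd that by (intro card_frequent_le) auto
  have bnd': "F' r c \<subseteq> {..<q} \<and> card (F' r c) \<le> (g(b := 2 * g b)) r" if "r \<in> W - {v}" for r c
  proof -
    consider "r = a" | "r = b" "r \<noteq> a" | "r \<noteq> a" "r \<noteq> b" by blast
    then show ?thesis
    proof cases
      case 1
      have *: "card (often a c t1) * t1 \<le> q * g a" using often that 1 by blast
      have "q < 2 * t1" by (simp add: t1_def)
      moreover have "q * g a \<le> q" using r(2) by (cases "g a") auto
      ultimately have "card (often a c t1) * t1 < 2 * t1" using * by linarith
      then have "card (often a c t1) \<le> 1" by simp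
      then show ?thesis using 1 r by (auto simp: F'_def often_def)
    next
      case 2
      have le: "card (often b c t2) * t2 \<le> q * g b" using often that 2 by blast
      have t2: "2 * q < 5 * t2" using q unfolding t2_def by linarith
      have "card (often b c t2) \<le> 2 * g b"
      proof (rule ccontr)
        assume "\<not> ?thesis"
        then have "(2 * g b + 1) * t2 \<le> q * g b"
          using le mult_le_mono1[of "2 * g b + 1" "card (often b c t2)" t2] by linarith
        moreover have "g b = 0 \<or> g b = 1 \<or> g b = 2" using r(3) by linarith
        ultimately show False using t2 by auto
      qed
      then show ?thesis using 2 by (auto simp: F'_def often_def)
    next
      case 3
      then show ?thesis using bnd that by (auto simp: F'_def)
    qed
  qed
  have loc': "F' r c = F' r c'"
    if rW: "r \<in> W - {v}" and agree: "\<forall>w\<in>W - {v}. E r w \<longrightarrow> c w = c' w" for r c c'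
  proof -
    have *: "F r (c(v := \<gamma>)) = F r (c'(v := \<gamma>))" for \<gamma>
      using loc[rule_format, of r "c(v := \<gamma>)" "c'(v := \<gamma>)"] rW agree by auto
    have "often r c t = often r c' t" for t unfolding often_def by (simp only: *)
    moreover have "F r c = F r c'" if "r \<noteq> a" "r \<noteq> b"
      using loc[rule_format, of r c c'] rW agree nb[of r] that by blast
    ultimately show ?thesis by (auto simp: F'_def)
  qed
  obtain c where c: "\<And>v. c v < q" "\<And>r. r \<in> W - {v} \<Longrightarrow> c r \<notin> F' r c"
    using adversary_winsD[of E q "W - {v}" _ F', OF win bnd' loc'] by blast
  \<comment> \<open>These are the colours of \<open>v\<close> at which \<open>r\<close> would guess
    its own colour; there are none if \<open>r\<close> is a dummy outside
    \<open>W - {v}\<close>.\<close>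
  let ?B = "\<lambda>r. if r \<in> W - {v} then {\<gamma>. \<gamma> < q \<and> c r \<in> F r (c(v := \<gamma>))} else {}"
  have "card (?B a) < t1"
    using c(1)[of a] c(2)[of a] by (auto simp: F'_def often_def t1_def not_le)
  moreover have "card (?B b) < t2"
    using c(1)[of b] c(2)[of b] r(1) q by (auto simp: F'_def often_def not_le t2_def)
  moreover have "card (F v c) \<le> 4" using bnd v by (meson order_trans)
  moreover have "t1 + t2 + 3 = q" using q unfolding t1_def t2_def by linarith
  moreover have "card (?B a \<union> ?B b \<union> F v c) \<le> card (?B a) + card (?B b) + card (F v c)"
    by (meson card_Un_le add_le_mono1 order_trans)
  ultimately have "card (?B a \<union> ?B b \<union> F v c) < card {..<q}" by simp
  moreover have "finite (?B a \<union> ?B b \<union> F v c)"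
    using bnd v by (auto intro: finite_subset[of _ "{..<q}"])
  ultimately have "\<not> {..<q} \<subseteq> ?B a \<union> ?B b \<union> F v c"
    using card_mono[of "?B a \<union> ?B b \<union> F v c" "{..<q}"] by linarith
  then obtain \<gamma> where \<gamma>: "\<gamma> < q" "\<gamma> \<notin> ?B a" "\<gamma> \<notin> ?B b" "\<gamma> \<notin> F v c"
    by blast
  have "(c(v := \<gamma>)) r \<notin> F r (c(v := \<gamma>))" if "r \<in> W" for r
  proof (cases "r = v")
    case True
    have "F v (c(v := \<gamma>)) = F v c" by (rule loc[rule_format]) (use v in auto)
    then show ?thesis using True \<gamma> by simp
  next
    case False
    show ?thesis
    proof (cases "r = a \<or> r = b")
      case True
      then show ?thesis using False \<gamma> that by auto
    next
      case 2: False
      then have "F r (c(v := \<gamma>)) = F r c"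
        using nb[of r] that by (intro loc[rule_format]) auto
      moreover have "c r \<notin> F r c" using c(2)[of r] that False 2 by (auto simp: F'_def)
      ultimately show ?thesis using False by simp
    qed
  qed
  then show "\<exists>c. (\<forall>v. c v < q) \<and> (\<forall>v\<in>W. c v \<notin> F v c)"
    using c(1) \<gamma>(1) by (intro exI[of _ "c(v := \<gamma>)"]) auto
qed

text \<open>An ordinary strategy is the case of singleton guess sets, and since edges stay within
  \<open>V\<close>, seeing the neighbours in \<open>V\<close> means seeing all neighbours.\<close>

lemma not_hat_winning_if_adversary_wins:
  fixes V :: "'a set"
  assumes "adversary_wins E q V (\<lambda>_. 1)" "\<And>u v. E u v \<Longrightarrow> v \<in> V"
  shows "\<not> hat_winning V E q"
proof
  assume "hat_winning V E q"
  then obtain f where f: "hat_strategy E q f"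
    and wins: "\<forall>c. (\<forall>v\<in>V. c v < q) \<longrightarrow> (\<exists>v\<in>V. f v c = c v)"
    unfolding hat_winning_def by blast
  have "\<forall>v\<in>V. \<forall>c. {f v c} \<subseteq> {..<q} \<and> card {f v c} \<le> 1"
    using f by (auto simp: hat_strategy_def)
  moreover have "\<forall>v\<in>V. \<forall>c c'. (\<forall>w\<in>V. E v w \<longrightarrow> c w = c' w) \<longrightarrow> {f v c} = {f v c'}"
  proof (intro ballI allI impI)
    fix v :: 'a and c c' :: "'a \<Rightarrow> nat" assume "\<forall>w\<in>V. E v w \<longrightarrow> c w = c' w"
    then have "\<forall>w. E v w \<longrightarrow> c w = c' w" using assms(2) by blast
    then show "{f v c} = {f v c'}" using f unfolding hat_strategy_def by blast
  qed
  ultimately have "\<exists>c. (\<forall>v. c v < q) \<and> (\<forall>v\<in>V. c v \<notin> {f v c})"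
    by (rule assms(1)[unfolded adversary_wins_def, THEN spec, THEN mp, THEN mp])
  then show False using wins by (metis singletonI)
qed

section \<open>Dismantling a triangulated polygon\<close>

text \<open>A binary tree encodes a triangulation of a polygon with base edge \<open>{u, w}\<close> whose remaining
  vertices, in order from \<open>u\<close> to \<open>w\<close>, are the inorder traversal; the root is the apex of the triangle on the base.
  The left spine consists of the neighbours of \<open>u\<close> other than \<open>w\<close>.\<close>

fun tri_edges :: "'a tree \<Rightarrow> 'a \<Rightarrow> 'a \<Rightarrow> 'a set set" where
  "tri_edges Leaf u w = {{u, w}}"
| "tri_edges (Node l x r) u w = insert {u, w} (tri_edges l u x \<union> tri_edges r x w)"

fun left_spine :: "'a tree \<Rightarrow> 'a set" where
  "left_spine Leaf = {}"
| "left_spine (Node l x r) = insert x (left_spine l)"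

lemma tri_edges_subset: "e \<in> tri_edges T u w \<Longrightarrow> e \<subseteq> insert u (insert w (set_tree T))"
  by (induction T arbitrary: u w) fastforce+

lemma tri_edges_mirror: "tri_edges (mirror T) w u = tri_edges T u w"
  by (induction T arbitrary: u w) (auto simp: insert_commute)

lemma left_spine_subset: "left_spine T \<subseteq> set_tree T"
  by (induction T) auto

lemma set_tree_mirror: "set_tree (mirror T) = set_tree T"
  by (metis inorder_mirror set_inorder set_rev)

lemma tri_edges_left:
  assumes "{w, v} \<in> tri_edges (Node l x r) a b" "v \<in> set_tree l" "distinct (a # inorder (Node l x r) @ [b])"
  shows "{w, v} \<in> tri_edges l a x"
  using assms tri_edges_subset[of "{w, v}" r x b] by (auto simp: doubleton_eq_iff)

lemma tri_edges_right:
  assumes "{w, v} \<in> tri_edges (Node l x r) a b" "v \<in> set_tree r" "distinct (a # inorder (Node l x r) @ [b])"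
  shows "{w, v} \<in> tri_edges r x b"
  using assms tri_edges_subset[of "{w, v}" l a x] by (auto simp: doubleton_eq_iff)

lemma tri_edges_apex:
  assumes "{w, x} \<in> tri_edges (Node l x r) a b"
  shows "w \<in> insert a (insert b (insert x (set_tree l \<union> set_tree r)))"
  using tri_edges_subset[OF assms] by auto

section \<open>Clearing a triangulated polygon down to its base edge\<close>

text \<open>With everything behind it gone, the spine is a path whose vertices see, besides
  \<open>u\<close>, only their neighbours on the path and, at its top, \<open>x\<close>. It is
  deleted from the end far from \<open>x\<close>: each deletion doubles the next vertex towards
  \<open>x\<close>, the last one doubles \<open>x\<close>, and \<open>u\<close> with its single
  guess is never charged. Starting from at most 2 guesses, a spine vertex has at most 4 when it is
  deleted.\<close>

lemma adversary_wins_spine: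
  assumes q: "q \<ge> 41" and irr: "\<And>v. \<not> E v v"
    and "distinct (u # inorder T @ [x])" "W \<inter> set_tree T = left_spine T"
    and "\<And>v w. v \<in> left_spine T \<Longrightarrow> w \<in> W \<Longrightarrow> E w v \<Longrightarrow> {w, v} \<in> tri_edges T u x"
    and "g u = 1" "\<And>v. v \<in> left_spine T \<Longrightarrow> g v \<le> 2" "g x \<le> 2"
    and "adversary_wins E q (W - set_tree T) (g(x := 2 * g x))"
  shows "adversary_wins E q W g"
  using assms(3-)
proof (induction T arbitrary: W g x)
  case Leaf
  then have "adversary_wins E q W (g(x := 2 * g x))" by (simp add: fun_upd_def)
  then show ?case by (rule adversary_wins_mono) simp
next
  case (Node l y r)
  let ?T = "Node l y r" and ?W = "W - set_tree l" and ?g = "g(y := 2 * g y)"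
  note dist = Node.prems(1)
  have mem: "v \<in> W \<Longrightarrow> v \<in> set_tree r \<Longrightarrow> False" for v
    using Node.prems(1) left_spine_subset[of l] IntI[of v W "set_tree (Node l y r)"]
    unfolding Node.prems(2) by auto
  show ?case
  proof (rule Node.IH(1)[of y])
    show "distinct (u # inorder l @ [y])" "g u = 1" "\<And>v. v \<in> left_spine l \<Longrightarrow> g v \<le> 2" "g y \<le> 2"
      using Node.prems by auto
    show "W \<inter> set_tree l = left_spine l"
      using Node.prems(1,2) left_spine_subset[of l] by auto
    show "{w, v} \<in> tri_edges l u y" if "v \<in> left_spine l" "w \<in> W" "E w v" for v w
      using Node.prems(3)[of v w] that left_spine_subset[of l] tri_edges_left[OF _ _ dist] by auto
    show "adversary_wins E q ?W ?g"
    proof (rule adversary_wins_eliminate[OF q, where v = y and a = u and b = x])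
      show "y \<in> ?W" using Node.prems(1,2) by auto
      show "w = u \<or> w = x" if "w \<in> ?W" "E w y" for w
        using tri_edges_apex[OF Node.prems(3)[of y w]] that mem[of w] irr[of y] by auto
      have "?W - {y} = W - set_tree ?T" using mem by auto
      then have "adversary_wins E q (?W - {y}) (g(x := 2 * g x))" using Node.prems(7) by (simp add: fun_upd_def)
      then show "adversary_wins E q (?W - {y}) (?g(x := 2 * ?g x))"
        by (rule adversary_wins_mono) (use Node.prems(1) in auto)
    qed (use irr Node.prems in auto)
  qed
qed

text \<open>The invariant of the induction on trees. Only \<open>u\<close> pays, by a doubling,
  while \<open>w\<close> keeps its single guess; this asymmetry lets charges be steered away from a
  chosen vertex.\<close>

definition fan_removable :: "('a \<Rightarrow> 'a \<Rightarrow> bool) \<Rightarrow> nat \<Rightarrow> 'a tree \<Rightarrow> bool" where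
  "fan_removable E q T \<longleftrightarrow> (\<forall>u w W g.
     distinct (u # inorder T @ [w]) \<longrightarrow> set_tree T \<subseteq> W \<longrightarrow>
     (\<forall>v \<in> set_tree T. \<forall>z \<in> W. E z v \<longrightarrow> {z, v} \<in> tri_edges T u w) \<longrightarrow>
     (\<forall>v \<in> insert u (insert w (set_tree T)). g v = 1) \<longrightarrow>
     adversary_wins E q (W - set_tree T) (g(u := 2)) \<longrightarrow> adversary_wins E q W g)"

lemma fan_removableD:
  assumes "fan_removable E q T" "distinct (u # inorder T @ [w])" "set_tree T \<subseteq> W"
    and "\<And>v z. v \<in> set_tree T \<Longrightarrow> z \<in> W \<Longrightarrow> E z v \<Longrightarrow> {z, v} \<in> tri_edges T u w"
    and "\<And>v. v \<in> insert u (insert w (set_tree T)) \<Longrightarrow> g v = 1"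
    and "adversary_wins E q (W - set_tree T) (g(u := 2))"
  shows "adversary_wins E q W g"
  using assms(1)[unfolded fan_removable_def, rule_format, OF assms(2,3) _ _ assms(6)] assms(4,5) by blast

text \<open>The right subtrees hanging off the spine are smaller polygons, on bases joining
  consecutive spine vertices or the top one and \<open>x\<close>. Each is charged to the end of its
  base farther from \<open>x\<close>, so every spine vertex is doubled once and \<open>x\<close> not
  at all.\<close>

lemma adversary_wins_behind_spine:
  assumes "\<And>T'. size T' < size T \<Longrightarrow> fan_removable E q T'"
    and "distinct (u # inorder T @ [x])" "set_tree T \<subseteq> W"
    and "\<And>v w. v \<in> set_tree T \<Longrightarrow> w \<in> W \<Longrightarrow> E w v \<Longrightarrow> {w, v} \<in> tri_edges T u x"
    and "\<And>v. v \<in> insert x (set_tree T) \<Longrightarrow> g v = 1"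
    and "adversary_wins E q (W - (set_tree T - left_spine T)) (\<lambda>v. if v \<in> left_spine T then 2 else g v)"
  shows "adversary_wins E q W g"
  using assms
proof (induction T arbitrary: W g x)
  case Leaf
  then show ?case by simp
next
  case (Node l y r)
  let ?T = "Node l y r" and ?W = "W - (set_tree l - left_spine l)"
    and ?g = "\<lambda>v. if v \<in> left_spine l then 2 else g v"
  note dist = Node.prems(2)
  show ?case
  proof (rule Node.IH(1)[of y])
    show "fan_removable E q T'" if "size T' < size l" for T'
      using that Node.prems(1) by simp
    show "distinct (u # inorder l @ [y])" "set_tree l \<subseteq> W"
      using Node.prems(2,3) by auto
    show "g v = 1" if "v \<in> insert y (set_tree l)" for v
      using that Node.prems(5)[of v] by auto
    show "{w, v} \<in> tri_edges l u y" if "v \<in> set_tree l" "w \<in> W" "E w v" for v w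
      using Node.prems(4)[of v w] that tri_edges_left[OF _ _ dist] by auto
    show "adversary_wins E q ?W ?g"
    proof (rule fan_removableD[of E q r y x])
      show "fan_removable E q r" using Node.prems(1) by simp
      show "distinct (y # inorder r @ [x])" "set_tree r \<subseteq> ?W"
        using Node.prems(2,3) by auto
      show "{w, v} \<in> tri_edges r y x" if "v \<in> set_tree r" "w \<in> ?W" "E w v" for v w
        using Node.prems(4)[of v w] that tri_edges_right[OF _ _ dist] by auto
      show "?g v = 1" if "v \<in> insert y (insert x (set_tree r))" for v
        using that Node.prems(2) Node.prems(5)[of v] left_spine_subset[of l] by auto
      have "?W - set_tree r = W - (set_tree ?T - left_spine ?T)"
        using dist left_spine_subset[of l] by auto
      moreover have "?g(y := 2) = (\<lambda>v. if v \<in> left_spine ?T then 2 else g v)" by auto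
      ultimately show "adversary_wins E q (?W - set_tree r) (?g(y := 2))" using Node.prems(6) by simp
    qed
  qed
qed


text \<open>The order of deletion is: everything behind the spine on the side of \<open>u\<close>,
  the same on the side of \<open>w\<close>, the two spines, and finally the apex, for which
  \<open>u\<close> pays. The induction is on size because the side of \<open>w\<close> is treated
  through \<open>mirror r\<close>.\<close>

lemma fan_removable:
  assumes q: "q \<ge> 41" and irr: "\<And>v. \<not> E v v"
  shows "fan_removable E q T"
proof (induction T rule: measure_induct_rule[of size])
  case (less T)
  show ?case
  proof (cases T)
    case Leaf
    show ?thesis
      unfolding fan_removable_def Leaf
    proof (intro allI impI)
      fix u w W and g :: "'a \<Rightarrow> nat"
      assume "\<forall>v\<in>insert u (insert w (set_tree \<langle>\<rangle>)). g v = 1"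
        and "adversary_wins E q (W - set_tree \<langle>\<rangle>) (g(u := 2))"
      then have "adversary_wins E q W (g(u := 2))" "g u = 1" by (simp_all add: fun_upd_def)
      then show "adversary_wins E q W g" by (auto intro: adversary_wins_mono[of _ _ _ "g(u := 2)"])
    qed
  next
    case (Node l x r)
    show ?thesis
      unfolding fan_removable_def
    proof (intro allI impI)
      fix u w W and g :: "'a \<Rightarrow> nat"
      assume dist: "distinct (u # inorder T @ [w])" and sub: "set_tree T \<subseteq> W"
        and edg: "\<forall>v\<in>set_tree T. \<forall>z\<in>W. E z v \<longrightarrow> {z, v} \<in> tri_edges T u w"
        and one: "\<forall>v\<in>insert u (insert w (set_tree T)). g v = 1"
        and win: "adversary_wins E q (W - set_tree T) (g(u := 2))"
      let ?m = "mirror r"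
      note dist' = dist[unfolded Node]
      have IHl: "size T' < size l \<Longrightarrow> fan_removable E q T'"
        and IHr: "size T' < size ?m \<Longrightarrow> fan_removable E q T'" for T'
        using less.IH by (simp_all add: Node)
      have spl: "left_spine l \<subseteq> set_tree l" and spr: "left_spine ?m \<subseteq> set_tree r"
        using left_spine_subset[of l] left_spine_subset[of ?m] by (simp_all add: set_tree_mirror)
      have dl: "distinct (u # inorder l @ [x])" and dr: "distinct (w # inorder ?m @ [x])"
        using dist' by (auto simp: inorder_mirror)
      have dj: "x \<notin> set_tree l" "x \<notin> set_tree r" "set_tree l \<inter> set_tree r = {}" "u \<noteq> x" "w \<noteq> x" "u \<noteq> w"
        "u \<notin> set_tree l" "u \<notin> set_tree r" "w \<notin> set_tree l" "w \<notin> set_tree r"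
        using dist' by auto
      have el: "{z, v} \<in> tri_edges l u x" if "v \<in> set_tree l" "z \<in> W" "E z v" for v z
        by (rule tri_edges_left[OF _ that(1) dist']) (use edg that in \<open>simp add: Node\<close>)
      have er: "{z, v} \<in> tri_edges ?m w x" if "v \<in> set_tree r" "z \<in> W" "E z v" for v z
        unfolding tri_edges_mirror
        by (rule tri_edges_right[OF _ that(1) dist']) (use edg that in \<open>simp add: Node\<close>)
      have ex: "z \<in> {u, w} \<union> set_tree l \<union> set_tree r" if "z \<in> W" "E z x" for z
        using tri_edges_apex[of z x l r u w] edg that irr by (auto simp: Node)
      have set_T: "set_tree T = insert x (set_tree l \<union> set_tree r)" by (auto simp: Node)
      txt \<open>The charges point away from the apex \<open>x\<close>, so \<open>x\<close> is not charged by the deletions behind the two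
        spines. It is then doubled once from each side and still makes at most 4 guesses when it is deleted.\<close>
      define W1 where "W1 = W - (set_tree l - left_spine l)"
      define W2 where "W2 = W1 - (set_tree r - left_spine ?m)"
      define W3 where "W3 = W2 - set_tree l"
      define W4 where "W4 = W3 - set_tree r"
      define g1 where "g1 = (\<lambda>v. if v \<in> left_spine l then 2 else g v)"
      define g2 where "g2 = (\<lambda>v. if v \<in> left_spine ?m then 2 else g1 v)"
      define g3 where "g3 = g2(x := 2 * g2 x)"
      define g4 where "g4 = g3(x := 2 * g3 x)"
      have g: "g u = 1" "g w = 1" "g x = 1" "\<And>v. v \<in> set_tree l \<Longrightarrow> g v = 1"
        "\<And>v. v \<in> set_tree r \<Longrightarrow> g v = 1"
        using one by (auto simp: set_T)
      \<comment> \<open>The stages are established backwards, since each claim follows from the one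
        on the smaller vertex set.\<close>
      have W4: "adversary_wins E q W4 g4"
      proof (rule adversary_wins_eliminate[OF q, where v = x and a = w and b = u])
        show "x \<in> W4" using sub dj by (auto simp: set_T W4_def W3_def W2_def W1_def)
        show "g4 x \<le> 4" "g4 w = 1" "g4 u \<le> 2"
          using g dj spl spr by (auto simp: g4_def g3_def g2_def g1_def)
        show "z = w \<or> z = u" if "z \<in> W4" "E z x" for z
          using ex[of z] that by (auto simp: W4_def W3_def W2_def W1_def)
        have "W4 - {x} = W - set_tree T"
          using spl spr by (auto simp: set_T W4_def W3_def W2_def W1_def)
        then have "adversary_wins E q (W4 - {x}) (g(u := 2))" using win by simp
        then show "adversary_wins E q (W4 - {x}) (g4(u := 2 * g4 u))"
          by (rule adversary_wins_mono)
            (use g dj spl spr in \<open>auto simp: g4_def g3_def g2_def g1_def W4_def W3_def\<close>)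
      qed (use irr dj in auto)
      have W3: "adversary_wins E q W3 g3"
      proof (rule adversary_wins_spine[OF q irr dr])
        show "W3 \<inter> set_tree ?m = left_spine ?m"
          using spr dj sub by (auto simp: set_tree_mirror set_T W3_def W2_def W1_def)
        show "{z, v} \<in> tri_edges ?m w x" if "v \<in> left_spine ?m" "z \<in> W3" "E z v" for v z
          using er[of v z] spr that by (auto simp: W3_def W2_def W1_def)
        show "g3 w = 1" "g3 x \<le> 2" using g dj spl spr by (auto simp: g3_def g2_def g1_def)
        show "g3 v \<le> 2" if "v \<in> left_spine ?m" for v
          using that dj spr by (auto simp: g3_def g2_def)
        show "adversary_wins E q (W3 - set_tree ?m) (g3(x := 2 * g3 x))"
          using W4 by (simp add: W4_def g4_def set_tree_mirror)
      qed
      have W2: "adversary_wins E q W2 g2"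
      proof (rule adversary_wins_spine[OF q irr dl])
        show "W2 \<inter> set_tree l = left_spine l"
          using spl dj sub by (auto simp: set_T W2_def W1_def)
        show "{z, v} \<in> tri_edges l u x" if "v \<in> left_spine l" "z \<in> W2" "E z v" for v z
          using el[of v z] spl that by (auto simp: W2_def W1_def)
        show "g2 u = 1" "g2 x \<le> 2" using g dj spl spr by (auto simp: g2_def g1_def)
        show "g2 v \<le> 2" if "v \<in> left_spine l" for v
          using that by (auto simp: g2_def g1_def)
        show "adversary_wins E q (W2 - set_tree l) (g2(x := 2 * g2 x))"
          using W3 by (simp add: W3_def g3_def)
      qed
      have W1: "adversary_wins E q W1 g1"
      proof (rule adversary_wins_behind_spine[OF IHr dr])
        show "set_tree ?m \<subseteq> W1" using dj sub by (auto simp: set_tree_mirror set_T W1_def)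
        show "{z, v} \<in> tri_edges ?m w x" if "v \<in> set_tree ?m" "z \<in> W1" "E z v" for v z
          using er[of v z] that by (auto simp: W1_def set_tree_mirror)
        show "g1 v = 1" if "v \<in> insert x (set_tree ?m)" for v
          using that g dj spl by (auto simp: g1_def set_tree_mirror)
        show "adversary_wins E q (W1 - (set_tree ?m - left_spine ?m)) (\<lambda>v. if v \<in> left_spine ?m then 2 else g1 v)"
          using W2 by (simp add: W2_def g2_def set_tree_mirror)
      qed
      show "adversary_wins E q W g"
      proof (rule adversary_wins_behind_spine[OF IHl dl])
        show "set_tree l \<subseteq> W" using sub by (auto simp: set_T)
        show "g v = 1" if "v \<in> insert x (set_tree l)" for v
          using that g by auto
        show "adversary_wins E q (W - (set_tree l - left_spine l)) (\<lambda>v. if v \<in> left_spine l then 2 else g v)"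
          using W1 by (simp add: W1_def g1_def)
      qed (use el in auto)
    qed
  qed
qed

section \<open>From non-crossing orders to triangulated polygons\<close>

text \<open>The vertices sit on a circle in the order of the list and the edges are chords;
  \<open>subseq\<close> picks four of them in that order.\<close>

definition noncrossing :: "('a \<Rightarrow> 'a \<Rightarrow> bool) \<Rightarrow> 'a list \<Rightarrow> bool" where
  "noncrossing E xs \<longleftrightarrow> (\<forall>a b c d. subseq [a, b, c, d] xs \<longrightarrow> \<not> (E a c \<and> E b d))"

lemma noncrossing_subseq: "noncrossing E ys \<Longrightarrow> subseq xs ys \<Longrightarrow> noncrossing E xs"
  unfolding noncrossing_def by (meson subseq_order.order_trans)

lemma noncrossing_triangulation:
  assumes sym: "\<And>u v. E u v \<Longrightarrow> E v u"
  shows "noncrossing E (u # zs @ [w]) \<Longrightarrow>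
    \<exists>T. inorder T = zs \<and> (\<forall>a b. a \<in> set (u # zs @ [w]) \<longrightarrow> b \<in> set (u # zs @ [w]) \<longrightarrow> E a b \<longrightarrow>
           a \<noteq> b \<longrightarrow> {a, b} \<in> tri_edges T u w)"
proof (induction zs arbitrary: u w rule: length_induct)
  case (1 zs)
  show ?case
  proof (cases "zs = []")
    case True
    then show ?thesis by (intro exI[of _ Leaf]) auto
  next
    case False
    \<comment> \<open>The apex is the last vertex of \<open>zs\<close> adjacent to \<open>u\<close>,
      so that no edge leads from \<open>u\<close> to a vertex of \<open>bs\<close>. If there is
      none, the first vertex of \<open>zs\<close> serves and \<open>as\<close> is empty.\<close>
    have "\<exists>as x bs. zs = as @ x # bs \<and> (as = [] \<or> E u x) \<and> (\<forall>z\<in>set bs. \<not> E u z)"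
    proof (cases "\<exists>z\<in>set zs. E u z")
      case True
      then show ?thesis using split_list_last_prop[of zs "E u"] by metis
    next
      case 2: False
      then show ?thesis using False by (metis append_Nil list.exhaust list.set_intros(2))
    qed
    then obtain as x bs where zs: "zs = as @ x # bs" and as: "as = [] \<or> E u x"
      and bs: "\<And>z. z \<in> set bs \<Longrightarrow> \<not> E u z" by blast
    have "subseq ((u # as @ [x]) @ []) ((u # as @ [x]) @ (bs @ [w]))"
      and "subseq ([] @ (x # bs @ [w])) ((u # as) @ (x # bs @ [w]))"
      by (intro list_emb_append_mono; simp)+
    then have nc: "noncrossing E (u # as @ [x])" "noncrossing E (x # bs @ [w])"
      using noncrossing_subseq[OF 1(2)] by (simp_all add: zs)
    obtain L where L: "inorder L = as" "\<And>a b. a \<in> set (u # as @ [x]) \<Longrightarrow> b \<in> set (u # as @ [x]) \<Longrightarrow> E a b \<Longrightarrow>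
           a \<noteq> b \<Longrightarrow> {a, b} \<in> tri_edges L u x"
      using 1(1)[rule_format, OF _ nc(1)] zs by auto
    obtain R where R: "inorder R = bs" "\<And>a b. a \<in> set (x # bs @ [w]) \<Longrightarrow> b \<in> set (x # bs @ [w]) \<Longrightarrow> E a b \<Longrightarrow>
           a \<noteq> b \<Longrightarrow> {a, b} \<in> tri_edges R x w"
      using 1(1)[rule_format, OF _ nc(2)] zs by auto
    \<comment> \<open>An edge jumping over the apex: from \<open>u\<close> it can only reach
      \<open>w\<close>, and from \<open>as\<close> it would cross the edge from \<open>u\<close> to
      \<open>x\<close>, which exists because \<open>as\<close> is then nonempty.\<close>
    have cross: "{a, b} = {u, w}"
      if "a \<in> insert u (set as)" "b \<in> insert w (set bs)" "E a b" for a b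
    proof (cases "a = u")
      case True
      then show ?thesis using that bs by blast
    next
      case False
      then have "a \<in> set as" using that by simp
      then have "E u x" using as by auto
      have "subseq ([u] @ [a] @ [x] @ [b]) ([u] @ as @ [x] @ (bs @ [w]))"
        using \<open>a \<in> set as\<close> that(2) by (intro list_emb_append_mono) (auto simp: subseq_singleton_left)
      then have "subseq [u, a, x, b] (u # zs @ [w])" by (simp add: zs)
      then have "\<not> (E u x \<and> E a b)" using 1(2) unfolding noncrossing_def by blast
      then show ?thesis using \<open>E u x\<close> that by blast
    qed
    have "{a, b} \<in> tri_edges (Node L x R) u w"
      if ab: "a \<in> set (u # zs @ [w])" "b \<in> set (u # zs @ [w])" "E a b" "a \<noteq> b" for a b
    proof -
      consider "a \<in> set (u # as @ [x])" "b \<in> set (u # as @ [x])" | "a \<in> set (x # bs @ [w])" "b \<in> set (x # bs @ [w])"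
        | "a \<in> insert u (set as)" "b \<in> insert w (set bs)" | "b \<in> insert u (set as)" "a \<in> insert w (set bs)"
        using ab(1,2) unfolding zs by auto
      then show ?thesis
      proof cases
        case 1
        then show ?thesis using L(2)[of a b] that by simp
      next
        case 2
        then show ?thesis using R(2)[of a b] that by simp
      next
        case 3
        then show ?thesis using cross that by simp
      next
        case 4
        then have "{b, a} = {u, w}" using cross sym that by blast
        then show ?thesis by (simp add: insert_commute)
      qed
    qed
    then show ?thesis using L(1) R(1) zs by (intro exI[of _ "Node L x R"]) auto
  qed
qed

text \<open>The first and last entries of \<open>xs\<close> form the base;
  \<open>fan_removable\<close> clears the rest and leaves two guesses at one end and one at the
  other.\<close>

lemma adversary_wins_noncrossing:
  fixes xs :: "'a list"
  assumes q: "q \<ge> 41" and irr: "\<And>v. \<not> E v v" and sym: "\<And>u v. E u v \<Longrightarrow> E v u"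
    and xs: "distinct xs" "noncrossing E xs"
  shows "adversary_wins E q (set xs) (\<lambda>_. 1)"
proof (cases "length xs \<le> 1")
  case True
  then consider "xs = []" | v where "xs = [v]"
    by (cases xs) auto
  then show ?thesis
  proof cases
    case 1
    then show ?thesis using adversary_wins_empty[of q E "\<lambda>_. 1"] q by simp
  next
    case (2 v)
    have "adversary_wins E q {v} (\<lambda>_. 1)"
      unfolding adversary_wins_def
    proof (intro allI impI)
      fix F :: "'a \<Rightarrow> ('a \<Rightarrow> nat) \<Rightarrow> nat set"
      assume F: "\<forall>v\<in>{v}. \<forall>c. F v c \<subseteq> {..<q} \<and> card (F v c) \<le> 1"
        and loc: "\<forall>x\<in>{v}. \<forall>c c'. (\<forall>w\<in>{v}. E x w \<longrightarrow> c w = c' w) \<longrightarrow> F x c = F x c'"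
      \<comment> \<open>A lone vertex sees nothing, so its guess set is constant and misses one of
        the \<open>q\<close> colours.\<close>
      have const: "F v c = F v (\<lambda>_. 0)" for c
        by (rule loc[rule_format]) (use irr in auto)
      have "card (F v (\<lambda>_. 0)) < card {..<q}" "finite (F v (\<lambda>_. 0))"
        using F[rule_format, of v "\<lambda>_. 0"] q finite_subset by auto
      then have "\<not> {..<q} \<subseteq> F v (\<lambda>_. 0)"
        using card_mono[of "F v (\<lambda>_. 0)" "{..<q}"] by linarith
      then obtain \<gamma> where "\<gamma> < q" "\<gamma> \<notin> F v (\<lambda>_. 0)" by blast
      then show "\<exists>c. (\<forall>v. c v < q) \<and> (\<forall>v\<in>{v}. c v \<notin> F v c)"
        using const[of "\<lambda>_. \<gamma>"] by (intro exI[of _ "\<lambda>_. \<gamma>"]) simp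
    qed
    then show ?thesis using 2 by simp
  qed
next
  case False
  then obtain u zs w where eq: "xs = u # zs @ [w]"
    by (metis One_nat_def append_Nil append_butlast_last_id hd_Cons_tl le_numeral_extra(4) length_Cons length_append_singleton list.size(3) zero_le)
  have "u \<noteq> w" using xs(1) eq by auto
  obtain T where T: "inorder T = zs" and edges: "\<And>a b. a \<in> set xs \<Longrightarrow> b \<in> set xs \<Longrightarrow> E a b \<Longrightarrow>
           a \<noteq> b \<Longrightarrow> {a, b} \<in> tri_edges T u w"
    using noncrossing_triangulation[of E u zs w, OF sym] xs(2) unfolding eq by metis
  have set_T: "set_tree T = set zs" using T by (metis set_inorder)
  show ?thesis
  proof (rule fan_removableD[OF fan_removable[OF q irr], where u = u and T = T and w = w])
    show "distinct (u # inorder T @ [w])" using xs(1) eq T by simp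
    show "set_tree T \<subseteq> set xs" using eq set_T by auto
    show "{z, v} \<in> tri_edges T u w" if "v \<in> set_tree T" "z \<in> set xs" "E z v" for v z
      using edges[of z v] that irr set_T eq by auto
    let ?g = "(\<lambda>_. 1)(u := 2) :: 'a \<Rightarrow> nat"
    have W: "set xs - set_tree T = {u, w}" using xs(1) eq set_T by auto
    show "adversary_wins E q (set xs - set_tree T) ?g"
      unfolding W
    \<comment> \<open>Only \<open>w\<close> can see \<open>u\<close>, so \<open>b = u\<close> is a
      dummy: the doubling falls on the vertex just deleted. When \<open>w\<close> is deleted in
      turn, both \<open>a = w\<close> and \<open>b = u\<close> are dummies.\<close>
    proof (rule adversary_wins_eliminate[OF q, where v = u and a = w and b = u])
      show "adversary_wins E q ({u, w} - {u}) (?g(u := 2 * ?g u))"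
      proof (rule adversary_wins_mono[of _ _ _ "\<lambda>_. 1"])
        have "adversary_wins E q {w} (\<lambda>_. 1)"
        proof (rule adversary_wins_eliminate[OF q, where v = w and a = w and b = u])
          show "adversary_wins E q ({w} - {w}) ((\<lambda>_. 1)(u := 2 * 1))"
            using adversary_wins_empty[of q E "(\<lambda>_. 1)(u := 2 * 1)"] q by simp
        qed (use \<open>u \<noteq> w\<close> irr in auto)
        then show "adversary_wins E q ({u, w} - {u}) (\<lambda>_. 1)"
          using \<open>u \<noteq> w\<close> by (simp add: insert_Diff_if)
      qed (use \<open>u \<noteq> w\<close> in auto)
    qed (use \<open>u \<noteq> w\<close> irr in auto)
  qed auto
qed

section \<open>Non-crossing orders\<close>

definition is_cycle :: "('a \<Rightarrow> 'a \<Rightarrow> bool) \<Rightarrow> 'a list \<Rightarrow> bool" where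
  "is_cycle E cs \<longleftrightarrow> distinct cs \<and> length cs \<ge> 2 \<and> successively E cs \<and> E (last cs) (hd cs)"

lemma is_cycle_rotate: "is_cycle E (xs @ ys) \<Longrightarrow> is_cycle E (ys @ xs)"
  by (cases "xs = []"; cases "ys = []") (auto simp: is_cycle_def successively_append_iff)

text \<open>Rotating a quadruple \<open>a, b, c, d\<close> preserves its two diagonals
  \<open>a, c\<close> and \<open>b, d\<close> up to order and direction.\<close>

lemma noncrossing_rotate:
  assumes sym: "\<And>u v. E u v \<Longrightarrow> E v u" and nc: "noncrossing E (xs @ ys)"
  shows "noncrossing E (ys @ xs)"
  unfolding noncrossing_def
proof (intro allI impI)
  fix a b c d assume "subseq [a, b, c, d] (ys @ xs)"
  then obtain s t where st: "[a, b, c, d] = s @ t" "subseq s ys" "subseq t xs"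
    using subseq_appendE by metis
  then have "subseq (t @ s) (xs @ ys)" by (intro list_emb_append_mono)
  moreover have "t @ s \<in> {[a, b, c, d], [b, c, d, a], [c, d, a, b], [d, a, b, c]}"
    using st(1) by (auto simp: Cons_eq_append_conv)
  ultimately have "subseq [a, b, c, d] (xs @ ys) \<or> subseq [b, c, d, a] (xs @ ys) \<or>
      subseq [c, d, a, b] (xs @ ys) \<or> subseq [d, a, b, c] (xs @ ys)"
    by auto
  then show "\<not> (E a c \<and> E b d)" using nc sym unfolding noncrossing_def by blast
qed

text \<open>A crossing quadruple contained in neither given list starts in \<open>xs\<close> and
  ends in \<open>ys\<close>. With at most one entry in \<open>ms\<close>, one of the pairs
  \<open>a, c\<close> and \<open>b, d\<close> has an end on each side, against \<open>sep\<close>;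
  two entries in \<open>ms\<close> could be \<open>b\<close> and \<open>c\<close>.\<close>

lemma noncrossing_glue:
  assumes nc: "noncrossing E (xs @ ms)" "noncrossing E (ms @ ys)" and len: "length ms \<le> 1"
    and sep: "\<And>x y. x \<in> set xs \<Longrightarrow> y \<in> set ys \<Longrightarrow> \<not> E x y"
  shows "noncrossing E (xs @ ms @ ys)"
  unfolding noncrossing_def
proof (intro allI impI notI)
  fix a b c d assume "subseq [a, b, c, d] (xs @ ms @ ys)" and E: "E a c \<and> E b d"
  then obtain r s t where rst: "[a, b, c, d] = r @ s @ t" "subseq r xs" "subseq s ms" "subseq t ys"
    by (metis subseq_appendE)
  have "subseq (r @ s) (xs @ ms)" "subseq (s @ t) (ms @ ys)"
    using rst by (auto intro!: list_emb_append_mono)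
  then have "r \<noteq> []" "t \<noteq> []" using nc E rst(1) unfolding noncrossing_def by (metis append_Nil append_Nil2)+
  moreover have "length s \<le> 1" using rst(3) len list_emb_length le_trans by blast
  ultimately have "a \<in> set r \<and> c \<in> set t \<or> b \<in> set r \<and> d \<in> set t"
    using rst(1) by (auto simp: Cons_eq_append_conv)
  moreover have "set r \<subseteq> set xs" "set t \<subseteq> set ys"
    using rst(2,4) by (auto dest: list_emb_set)
  ultimately show False using sep E by blast
qed

text \<open>Rotation brings a shared vertex to the end of one order and to the start of the other,
  where it becomes the \<open>ms\<close> of \<open>noncrossing_glue\<close>.\<close>

lemma noncrossing_if_separated:
  assumes sym: "\<And>u v. E u v \<Longrightarrow> E v u"
    and xs: "distinct xs" "noncrossing E xs" and ys: "distinct ys" "noncrossing E ys"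
    and one: "set xs \<inter> set ys \<subseteq> {v}"
    and sep: "\<And>x y. x \<in> set xs - set ys \<Longrightarrow> y \<in> set ys - set xs \<Longrightarrow> \<not> E x y"
  shows "\<exists>zs. distinct zs \<and> set zs = set xs \<union> set ys \<and> noncrossing E zs"
proof (cases "set xs \<inter> set ys = {}")
  case True
  then have "noncrossing E (xs @ [] @ ys)"
    using xs ys sep by (intro noncrossing_glue) auto
  then show ?thesis using xs ys True by (intro exI[of _ "xs @ ys"]) auto
next
  case False
  then have v: "v \<in> set xs" "v \<in> set ys" using one by auto
  obtain a b c d where eq: "xs = a @ v # b" "ys = c @ v # d"
    using v by (metis split_list)
  have "noncrossing E ((b @ a) @ [v])" "noncrossing E ([v] @ (d @ c))"
    using noncrossing_rotate[of E "a @ [v]" b, OF sym] noncrossing_rotate[of E c "v # d", OF sym] xs ys eq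
    by auto
  then have "noncrossing E ((b @ a) @ [v] @ (d @ c))"
    using xs(1) ys(1) eq sep one by (intro noncrossing_glue[of E "b @ a" "[v]" "d @ c"]) auto
  then show ?thesis
    using xs(1) ys(1) eq one by (intro exI[of _ "(b @ a) @ [v] @ (d @ c)"]) auto
qed

lemma noncrossing_cycle:
  assumes chords: "\<And>a A c C b B d D. is_cycle E (a # A @ c # C @ b # B @ d # D) \<Longrightarrow> \<not> (E a b \<and> E c d)"
    and cyc: "is_cycle E cs"
  shows "noncrossing E cs"
  unfolding noncrossing_def
proof (intro allI impI)
  fix a c b d assume "subseq [a, c, b, d] cs"
  then obtain P A C B D where "cs = P @ a # A @ c # C @ b # B @ d # D"
    by (auto dest!: list_emb_ConsD)
  then have "is_cycle E (a # A @ c # C @ b # B @ d # (D @ P))"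
    using cyc is_cycle_rotate[of E P "a # A @ c # C @ b # B @ d # D"] by simp
  then show "\<not> (E a b \<and> E c d)" by (rule chords)
qed

section \<open>Hamiltonian cycles in 2-connected graphs without theta subgraphs\<close>

text \<open>\<open>conn\<close> is 2-connectedness phrased through separations. If a longest cycle
  misses a vertex, some component off the cycle attaches to it at two vertices \<open>a\<close> and
  \<open>b\<close>. A path through the component lengthens the cycle if \<open>a\<close> and
  \<open>b\<close> are consecutive on it, and otherwise forms a forbidden theta with the two halves
  of the cycle.\<close>

lemma hamiltonian_cycle:
  assumes sym: "\<And>u v. E u v \<Longrightarrow> E v u" and irr: "\<And>v. \<not> E v v"
    and theta: "\<And>a b xs ys zs. \<lbrakk>xs \<noteq> []; ys \<noteq> []; zs \<noteq> []; distinct (a # b # xs @ ys @ zs);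
        successively E (a # xs @ [b]); successively E (a # ys @ [b]); successively E (a # zs @ [b])\<rbrakk> \<Longrightarrow> False"
    and fin: "finite W" and two: "card W \<ge> 2"
    and conn: "\<And>A B v. \<lbrakk>A \<union> B = W; A \<inter> B \<subseteq> {v}; A \<noteq> W; B \<noteq> W\<rbrakk> \<Longrightarrow> \<exists>a\<in>A - B. \<exists>b\<in>B - A. E a b"
  shows "\<exists>cs. is_cycle E cs \<and> set cs = W"
proof -
  obtain v where v: "v \<in> W" using two by fastforce
  then have "\<exists>a\<in>{v} - (W - {v}). \<exists>b\<in>(W - {v}) - {v}. E a b"
    using two by (intro conn[of _ _ v]) (auto simp: Diff_eq)
  then obtain b where "b \<in> W" "E v b" by auto
  then have "is_cycle E [v, b] \<and> set [v, b] \<subseteq> W"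
    using v sym irr by (auto simp: is_cycle_def)
  moreover have "\<forall>cs. is_cycle E cs \<and> set cs \<subseteq> W \<longrightarrow> length cs < Suc (card W)"
    by (metis card_mono distinct_card fin is_cycle_def less_Suc_eq_le)
  ultimately obtain cs where cs: "is_cycle E cs" "set cs \<subseteq> W"
    and longest: "\<And>ds. is_cycle E ds \<Longrightarrow> set ds \<subseteq> W \<Longrightarrow> length ds \<le> length cs"
    using ex_has_greatest_nat[of "\<lambda>cs. is_cycle E cs \<and> set cs \<subseteq> W" "[v, b]" length "Suc (card W)"] by blast
  have "set cs = W"
  proof (rule ccontr)
    assume "set cs \<noteq> W"
    have len: "length cs \<ge> 2" and dist: "distinct cs" using cs by (auto simp: is_cycle_def)
    then obtain c where "c \<in> set cs" "c \<in> W" using cs(2) by (cases cs) auto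
    then have "\<exists>a\<in>set cs - (W - set cs). \<exists>b\<in>(W - set cs) - set cs. E a b"
      using cs \<open>set cs \<noteq> W\<close> by (intro conn[of _ _ v]) auto
    then obtain a k where a: "a \<in> set cs" and k: "k \<in> W - set cs" "E a k" by auto
    \<comment> \<open>The component of \<open>k\<close> off the cycle; describing it by distinct
      paths provides the detour \<open>ps\<close> at once.\<close>
    define K where "K = {x. \<exists>ps. ps \<noteq> [] \<and> distinct ps \<and> successively E ps \<and> hd ps = k \<and> last ps = x \<and> set ps \<subseteq> W - set cs}"
    have "k \<in> K" using k unfolding K_def by (intro CollectI exI[of _ "[k]"]) auto
    have KW: "K \<subseteq> W - set cs"
    proof
      fix x assume "x \<in> K"
      then obtain ps where "ps \<noteq> []" "last ps = x" "set ps \<subseteq> W - set cs" unfolding K_def by blast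
      then show "x \<in> W - set cs" using last_in_set by blast
    qed
    have closed: "y \<in> K" if xK: "x \<in> K" and xy: "E x y" "y \<in> W - set cs" for x y
    proof -
      obtain ps where ps: "ps \<noteq> []" "distinct ps" "successively E ps" "hd ps = k" "last ps = x" "set ps \<subseteq> W - set cs"
        using xK unfolding K_def by auto
      show ?thesis
      proof (cases "y \<in> set ps")
        case True
        then obtain us vs where "ps = us @ y # vs" by (metis split_list)
        then show ?thesis using ps unfolding K_def
          by (intro CollectI exI[of _ "us @ [y]"]) (auto simp: successively_append_iff hd_append split: if_splits)
      next
        case False
        then show ?thesis using ps xy unfolding K_def
          by (intro CollectI exI[of _ "ps @ [y]"]) (auto simp: successively_append_iff)
      qed
    qed
    have "a \<notin> K" "a \<in> W" using a KW cs by auto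
    obtain w where w: "w \<in> set cs" "w \<noteq> a"
      using len dist a by (metis One_nat_def Suc_1 card_le_Suc0_iff_eq distinct_card finite_set not_less_eq_eq)
    \<comment> \<open>The two parts share only \<open>a\<close>, so some edge leaves
      \<open>K\<close> for a vertex \<open>b\<close> other than \<open>a\<close>;
      \<open>closed\<close> then forces \<open>b\<close> onto the cycle.\<close>
    have "\<exists>x\<in>insert a K - (W - K). \<exists>y\<in>(W - K) - insert a K. E x y"
      using KW w cs \<open>k \<in> K\<close> \<open>a \<in> W\<close> by (intro conn[of _ _ a]) auto
    then obtain x b where x: "x \<in> K" and b: "b \<in> W" "b \<notin> K" "b \<noteq> a" "E x b"
      using \<open>a \<notin> K\<close> \<open>a \<in> W\<close> by auto
    then have bcs: "b \<in> set cs" using closed by blast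
    obtain ps where ps: "ps \<noteq> []" "distinct ps" "successively E ps" "hd ps = k" "last ps = x" "set ps \<subseteq> W - set cs"
      using x unfolding K_def by auto
    obtain us vs where "cs = us @ a # vs" using a by (metis split_list)
    then have cyc': "is_cycle E (a # vs @ us)" and set': "set (a # vs @ us) = set cs" and len': "length (a # vs @ us) = length cs"
      using is_cycle_rotate[of E us "a # vs"] cs by auto
    then have "b \<in> set (vs @ us)" using bcs b by auto
    then obtain ys zs where split: "vs @ us = ys @ b # zs" by (metis split_list)
    have cyc: "is_cycle E (a # ys @ b # zs)" and set: "set (a # ys @ b # zs) = set cs"
      and leneq: "length (a # ys @ b # zs) = length cs"
      using cyc' set' len' split by auto
    have W: "a \<in> W" "b \<in> W" "set ps \<subseteq> W" "set ys \<subseteq> W" "set zs \<subseteq> W" "length ps > 0"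
      using set cs(2) ps(1,6) by auto
    have pdis: "set ps \<inter> set (a # ys @ b # zs) = {}" using ps(6) set by auto
    have pab: "successively E (a # ps @ [b])"
      using ps k b by (auto simp: successively_append_iff successively_Cons)
    have pba: "successively E (b # rev ps @ [a])"
      using pab sym successively_rev[of E "a # ps @ [b]"] by (auto elim!: successively_mono)
    show False
    proof (cases "ys = []")
      case True
      then have "is_cycle E (a # ps @ b # zs)"
        using cyc pab pdis ps by (auto simp: is_cycle_def successively_append_iff successively_Cons)
      then show False using longest[of "a # ps @ b # zs"] W leneq True by (simp del: length_greater_0_conv)
    next
      case ys: False
      show False
      proof (cases "zs = []")
        case True
        then have "is_cycle E (a # ys @ b # rev ps)"
          using cyc pba pdis ps ys by (auto simp: is_cycle_def successively_append_iff successively_Cons hd_rev last_rev hd_append)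
        then show False using longest[of "a # ys @ b # rev ps"] W leneq True by (simp del: length_greater_0_conv)
      next
        case zs: False
        have "successively E (b # zs @ [a])"
          using cyc zs by (auto simp: is_cycle_def successively_append_iff successively_Cons)
        then have "successively E (a # rev zs @ [b])"
          using sym successively_rev[of E "b # zs @ [a]"] by (auto elim!: successively_mono)
        moreover have "successively E (a # ys @ [b])"
          using cyc ys by (auto simp: is_cycle_def successively_append_iff successively_Cons)
        moreover have "distinct (a # b # ps @ ys @ rev zs)"
          using cyc pdis ps by (auto simp: is_cycle_def)
        ultimately show False using theta[of ps ys "rev zs" a b] ps(1) ys zs pab by simp
      qed
    qed
  qed
  then show ?thesis using cs by blast
qed

text \<open>Orders for the two sides of a separation can be glued; where no separation exists, a
  Hamiltonian cycle is itself the order.\<close>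

theorem noncrossing_order:
  assumes sym: "\<And>u v. E u v \<Longrightarrow> E v u" and irr: "\<And>v. \<not> E v v"
    and theta: "\<And>a b xs ys zs. \<lbrakk>xs \<noteq> []; ys \<noteq> []; zs \<noteq> []; distinct (a # b # xs @ ys @ zs);
        successively E (a # xs @ [b]); successively E (a # ys @ [b]); successively E (a # zs @ [b])\<rbrakk> \<Longrightarrow> False"
    and chords: "\<And>a A c C b B d D. is_cycle E (a # A @ c # C @ b # B @ d # D) \<Longrightarrow> \<not> (E a b \<and> E c d)"
    and "finite W"
  shows "\<exists>xs. distinct xs \<and> set xs = W \<and> noncrossing E xs"
  using \<open>finite W\<close>
proof (induction W rule: finite_psubset_induct)
  case (psubset W)
  show ?case
  proof (cases "card W \<ge> 2")
    case False
    obtain xs where xs: "set xs = W" "distinct xs" using psubset.hyps finite_distinct_list by blast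
    then have "length xs < 2" using False distinct_card by fastforce
    then have "noncrossing E xs" unfolding noncrossing_def by (auto dest: list_emb_length)
    then show ?thesis using xs by blast
  next
    case two: True
    show ?thesis
    proof (cases "\<exists>A B v. A \<union> B = W \<and> A \<inter> B \<subseteq> {v} \<and> A \<noteq> W \<and> B \<noteq> W \<and> \<not> (\<exists>a\<in>A - B. \<exists>b\<in>B - A. E a b)")
      case True
      then obtain A B v where AB: "A \<union> B = W" "A \<inter> B \<subseteq> {v}" "A \<noteq> W" "B \<noteq> W"
        and sep: "\<not> (\<exists>a\<in>A - B. \<exists>b\<in>B - A. E a b)" by blast
      then have "A \<subset> W" "B \<subset> W" by auto
      then obtain xs ys where "distinct xs" "set xs = A" "noncrossing E xs" "distinct ys" "set ys = B" "noncrossing E ys"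
        using psubset.IH by meson
      then show ?thesis
        using noncrossing_if_separated[of E xs ys v, OF sym] AB sep by auto
    next
      case False
      have "\<exists>cs. is_cycle E cs \<and> set cs = W"
      proof (rule hamiltonian_cycle[of E])
        show "\<exists>a\<in>A - B. \<exists>b\<in>B - A. E a b"
          if "A \<union> B = W" "A \<inter> B \<subseteq> {v}" "A \<noteq> W" "B \<noteq> W" for A B v
          using False that by metis
      qed (fact sym irr theta psubset.hyps two)+
      then obtain cs where "is_cycle E cs" "set cs = W" by blast
      moreover have "noncrossing E cs" by (rule noncrossing_cycle) (fact chords \<open>is_cycle E cs\<close>)+
      ultimately show ?thesis by (auto simp: is_cycle_def)
    qed
  qed
qed

section \<open>Theta curves\<close>

lemma theta_Jordan:
  fixes c1 c2 :: "real \<Rightarrow> complex"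
  assumes "arc c1" "pathstart c1 = a" "pathfinish c1 = b"
    and "arc c2" "pathstart c2 = a" "pathfinish c2 = b"
    and "path_image c1 \<inter> path_image c2 = {a, b}"
  defines "J \<equiv> path_image c1 \<union> path_image c2"
  shows "compact J" "inside J \<noteq> {}" "open (inside J)" "open (outside J)" "connected (inside J)" "connected (outside J)"
    "frontier (inside J) = J"
proof -
  have "simple_path (c1 +++ reversepath c2)"
    using assms by (intro simple_path_join_loop) (auto simp: arc_reversepath)
  moreover have "path_image (c1 +++ reversepath c2) = J"
    using assms by (simp add: path_image_join)
  moreover have "pathfinish (c1 +++ reversepath c2) = pathstart (c1 +++ reversepath c2)"
    using assms by simp
  ultimately show "inside J \<noteq> {}" "open (inside J)" "open (outside J)" "connected (inside J)" "connected (outside J)"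
    "frontier (inside J) = J" "compact J"
    using Jordan_inside_outside[of "c1 +++ reversepath c2"] compact_simple_path_image by metis+
qed

lemma connected_in_inside_or_outside:
  fixes J :: "complex set"
  assumes "connected S" "S \<inter> J = {}" "compact J"
  shows "S \<subseteq> inside J \<or> S \<subseteq> outside J"
proof -
  have "open (inside J)" "open (outside J)"
    using assms(3) compact_imp_closed open_inside open_outside by blast+
  moreover have "S \<subseteq> inside J \<union> outside J" using assms(2) by auto
  ultimately show ?thesis
    using connectedD[OF assms(1), of "inside J" "outside J"] inside_Int_outside[of J] by blast
qed

text \<open>If no arc of a theta curve lies inside the circle formed by the other two, the three insides
  are pairwise disjoint; Janiszewski's theorem then connects a point of one of them to infinity.\<close>

lemma theta_inside_subset_outside:
  fixes c1 c2 c3 :: "real \<Rightarrow> complex"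
  assumes c1: "arc c1" "pathstart c1 = a" "pathfinish c1 = b"
    and c2: "arc c2" "pathstart c2 = a" "pathfinish c2 = b"
    and c3: "arc c3" "pathstart c3 = a" "pathfinish c3 = b"
    and int: "path_image c1 \<inter> path_image c2 = {a, b}" "path_image c1 \<inter> path_image c3 = {a, b}"
      "path_image c2 \<inter> path_image c3 = {a, b}"
    and out: "path_image c3 - {a, b} \<subseteq> outside (path_image c1 \<union> path_image c2)"
      "path_image c2 - {a, b} \<subseteq> outside (path_image c1 \<union> path_image c3)"
  shows "inside (path_image c1 \<union> path_image c2) \<subseteq> outside (path_image c1 \<union> path_image c3)"
proof -
  let ?J12 = "path_image c1 \<union> path_image c2" and ?J13 = "path_image c1 \<union> path_image c3"
  note J12 = theta_Jordan[OF c1 c2 int(1)] and J13 = theta_Jordan[OF c1 c3 int(2)]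
  have "path_image c3 \<subseteq> outside ?J12 \<union> ?J12" using out(1) int(1) by blast
  then have "inside ?J12 \<inter> ?J13 = {}"
    using inside_no_overlap[of ?J12] inside_Int_outside[of ?J12] by blast
  then consider "inside ?J12 \<subseteq> inside ?J13" | "inside ?J12 \<subseteq> outside ?J13"
    using connected_in_inside_or_outside[OF J12(5) _ J13(1)] by blast
  then show ?thesis
  proof cases
    case 1
    \<comment> \<open>Passing to closures drags \<open>c2\<close> along, so that its interior would
      lie inside the circle of \<open>c1\<close> and \<open>c3\<close>, against
      \<open>out\<close>.\<close>
    have "?J12 \<subseteq> closure (inside ?J12)" using J12(7) by (metis Diff_subset frontier_def)
    also have "\<dots> \<subseteq> closure (inside ?J13)" using 1 closure_mono by blast
    also have "\<dots> \<subseteq> ?J13 \<union> inside ?J13"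
      using J13(1) closure_inside_subset compact_imp_closed by blast
    finally have "path_image c2 - {a, b} \<subseteq> inside ?J13" using int by blast
    moreover have "path_image c2 - {a, b} \<noteq> {}"
      using nonempty_simple_path_endless[of c2] c2 arc_imp_simple_path by blast
    ultimately show ?thesis using out(2) inside_Int_outside[of ?J13] by blast
  qed
qed

lemma theta_middle_arc:
  fixes c1 c2 c3 :: "real \<Rightarrow> complex"
  assumes c1: "arc c1" "pathstart c1 = a" "pathfinish c1 = b"
    and c2: "arc c2" "pathstart c2 = a" "pathfinish c2 = b"
    and c3: "arc c3" "pathstart c3 = a" "pathfinish c3 = b"
    and int: "path_image c1 \<inter> path_image c2 = {a, b}" "path_image c1 \<inter> path_image c3 = {a, b}"
      "path_image c2 \<inter> path_image c3 = {a, b}"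
  obtains "path_image c1 - {a, b} \<subseteq> inside (path_image c2 \<union> path_image c3)"
    | "path_image c2 - {a, b} \<subseteq> inside (path_image c1 \<union> path_image c3)"
    | "path_image c3 - {a, b} \<subseteq> inside (path_image c1 \<union> path_image c2)"
proof -
  let ?J12 = "path_image c1 \<union> path_image c2" and ?J13 = "path_image c1 \<union> path_image c3"
    and ?J23 = "path_image c2 \<union> path_image c3"
  note J12 = theta_Jordan[OF c1 c2 int(1)] and J13 = theta_Jordan[OF c1 c3 int(2)]
    and J23 = theta_Jordan[OF c2 c3 int(3)]
  have conn: "connected (path_image c - {a, b})" if "arc c" "pathstart c = a" "pathfinish c = b" for c :: "real \<Rightarrow> complex"
    using connected_simple_path_endless[of c] that arc_imp_simple_path by blast
  have False
    if out: "path_image c1 - {a, b} \<subseteq> outside ?J23" "path_image c2 - {a, b} \<subseteq> outside ?J13"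
      "path_image c3 - {a, b} \<subseteq> outside ?J12"
  proof -
    obtain x where x: "x \<in> inside ?J23" using J23(2) by blast
    have "inside ?J23 \<subseteq> outside ?J12"
      using theta_inside_subset_outside[OF c2 c3 c1] int out by (simp add: Int_commute Un_commute)
    moreover have "inside ?J23 \<subseteq> outside ?J13"
      using theta_inside_subset_outside[OF c3 c2 c1] int out by (simp add: Int_commute Un_commute)
    ultimately have x': "x \<in> outside ?J12" "x \<in> outside ?J13" using x by auto
    have "bounded (?J12 \<union> ?J13)" using J12(1) J13(1) compact_imp_bounded bounded_Un by blast
    then have "outside (?J12 \<union> ?J13) \<noteq> {}" by (rule outside_bounded_nonempty)
    then obtain y where "y \<in> outside (?J12 \<union> ?J13)" by blast
    then have y: "y \<in> outside ?J12" "y \<in> outside ?J13" "y \<in> outside ?J23"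
      using outside_mono[of ?J12 "?J12 \<union> ?J13"] outside_mono[of ?J13 "?J12 \<union> ?J13"]
        outside_mono[of ?J23 "?J12 \<union> ?J13"] by auto
    have "connected_component (- ?J12) x y" "connected_component (- ?J13) x y"
      using x' y J12(6) J13(6) outside_no_overlap[of ?J12] outside_no_overlap[of ?J13]
      unfolding connected_component_def by blast+
    \<comment> \<open>The two circles overlap exactly in the connected set \<open>c1\<close>, as
      Janiszewski's theorem requires, and their union contains the third circle.\<close>
    moreover have "?J12 \<inter> ?J13 = path_image c1" using int by blast
    then have "connected (?J12 \<inter> ?J13)" using c1 by (simp add: arc_imp_path connected_path_image)
    ultimately have "connected_component (- (?J12 \<union> ?J13)) x y"
      using Janiszewski J12(1) J13(1) compact_imp_closed by blast
    then have "connected_component (- ?J23) x y"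
      by (rule connected_component_of_subset) auto
    then show False using inside_same_component x y(3) inside_Int_outside[of ?J23] by blast
  qed
  moreover have "path_image c1 - {a, b} \<subseteq> inside ?J23 \<or> path_image c1 - {a, b} \<subseteq> outside ?J23"
    using connected_in_inside_or_outside[OF conn[OF c1] _ J23(1)] int by blast
  moreover have "path_image c2 - {a, b} \<subseteq> inside ?J13 \<or> path_image c2 - {a, b} \<subseteq> outside ?J13"
    using connected_in_inside_or_outside[OF conn[OF c2] _ J13(1)] int by blast
  moreover have "path_image c3 - {a, b} \<subseteq> inside ?J12 \<or> path_image c3 - {a, b} \<subseteq> outside ?J12"
    using connected_in_inside_or_outside[OF conn[OF c3] _ J12(1)] int by blast
  ultimately show ?thesis using that by blast
qed

text \<open>This is how outerplanarity enters. Near a frontier point inside \<open>J\<close> the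
  region \<open>U\<close> would meet the open inside; being connected and off \<open>J\<close>, it
  would then lie in one bounded component of the complement of \<open>J\<close>.\<close>

lemma inside_not_in_frontier:
  fixes J D :: "complex set"
  assumes J: "closed J" "J \<subseteq> D" and U: "U = connected_component_set (- D) z" "\<not> bounded U" and p: "p \<in> inside J"
  shows "p \<notin> frontier U"
proof
  assume "p \<in> frontier U"
  then have "p \<in> closure U" by (simp add: frontier_def)
  then have "inside J \<inter> U \<noteq> {}"
    using p J(1) open_inside[of J] open_Int_closure_eq_empty[of "inside J" U] by blast
  then obtain x where x: "x \<in> inside J" "x \<in> U" by blast
  have "connected U" "U \<subseteq> - J"
    using U(1) J(2) connected_component_subset[of "- D" z] by auto
  then have "U \<subseteq> connected_component_set (- J) x"
    using x(2) by (intro connected_component_maximal)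
  then show False using x(1) U(2) bounded_subset by (auto simp: inside_def)
qed

text \<open>By continuity; it carries the location of an open arc over to its ends.\<close>

lemma pathstart_pathfinish_in_closure_endless:
  fixes g :: "real \<Rightarrow> complex"
  assumes "arc g"
  shows "pathstart g \<in> closure (path_image g - {pathstart g, pathfinish g})"
    "pathfinish g \<in> closure (path_image g - {pathstart g, pathfinish g})"
proof -
  have eq: "path_image g - {pathstart g, pathfinish g} = g ` {0<..<1}"
    using assms simple_path_endless arc_imp_simple_path by blast
  have "g ` closure {0<..<1} \<subseteq> closure (g ` {0<..<1})"
    using assms by (intro image_closure_subset closure_subset) (auto simp: arc_def path_def)
  then have "g ` {0..1} \<subseteq> closure (path_image g - {pathstart g, pathfinish g})"
    by (simp add: eq)
  then show "pathstart g \<in> closure (path_image g - {pathstart g, pathfinish g})"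
    "pathfinish g \<in> closure (path_image g - {pathstart g, pathfinish g})"
    by (auto simp: pathstart_def pathfinish_def)
qed

section \<open>Outerplanar drawings\<close>

text \<open>The trace of a single vertex is empty, whence the requirement of length at least 2 in
  \<open>vertex_in_trace\<close> and \<open>arc_trace\<close>.\<close>

fun trace :: "('a \<Rightarrow> 'a \<Rightarrow> real \<Rightarrow> complex) \<Rightarrow> 'a list \<Rightarrow> complex set" where
  "trace crv (x # y # zs) = path_image (crv x y) \<union> trace crv (y # zs)"
| "trace crv _ = {}"

lemma trace_append: "trace crv (xs @ m # ys) = trace crv (xs @ [m]) \<union> trace crv (m # ys)"
  by (induction xs rule: induct_list012) auto

lemma in_traceE:
  assumes "p \<in> trace crv xs"
  obtains us x y vs where "xs = us @ x # y # vs" "p \<in> path_image (crv x y)"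
  using assms
proof (induction xs arbitrary: thesis rule: induct_list012)
  case (3 x y zs)
  from 3(4) consider "p \<in> path_image (crv x y)" | "p \<in> trace crv (y # zs)" by auto
  then show ?case
  proof cases
    case 1
    then show ?thesis using 3(3)[of "[]" x y zs] by simp
  next
    case 2
    then obtain us x' y' vs where "y # zs = us @ x' # y' # vs" "p \<in> path_image (crv x' y')"
      using 3(2) by blast
    then show ?thesis using 3(3)[of "x # us" x' y' vs] by simp
  qed
qed auto

text \<open>Serves to exclude a shared edge between two paths that have only their ends in common,
  since such an edge would join the ends.\<close>

lemma consecutive_not_ends:
  assumes "a # m @ [b] = us @ x # y # vs" "distinct (a # m @ [b])" "m \<noteq> []"
  shows "\<not> {x, y} \<subseteq> {a, b}"
proof
  assume sub: "{x, y} \<subseteq> {a, b}"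
  have "distinct (us @ x # y # vs)" using assms(1,2) by simp
  then have "x \<noteq> y" by auto
  have "y \<noteq> a" using assms(1) \<open>distinct (us @ x # y # vs)\<close> by (cases us) auto
  then have "x = a" "y = b" using sub \<open>x \<noteq> y\<close> by auto
  then have "us = []" using assms(1) \<open>distinct (us @ x # y # vs)\<close> by (cases us) auto
  then have "m @ [b] = b # vs" using assms(1) \<open>y = b\<close> by simp
  then show False using assms(2,3) by (cases m) auto
qed

lemma is_cycle_splitD:
  assumes "is_cycle E (a # xs @ b # ys)"
  shows "successively E (a # xs @ [b])" "successively E (b # ys @ [a])"
proof -
  have "successively E ((a # xs @ b # ys) @ [a])"
    using assms unfolding is_cycle_def successively_append_iff by simp
  then show "successively E (a # xs @ [b])" "successively E (b # ys @ [a])"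
    using successively_append_iff[of E "a # xs @ [b]" "ys @ [a]"] successively_append_iff[of E "a # xs" "b # ys @ [a]"]
    by simp_all
qed

locale outerplanar_drawing =
  fixes V :: "'a set" and E :: "'a \<Rightarrow> 'a \<Rightarrow> bool" and pos :: "'a \<Rightarrow> complex"
    and crv :: "'a \<Rightarrow> 'a \<Rightarrow> real \<Rightarrow> complex" and z :: complex
  assumes graph: "simple_graph V E" and drawing: "plane_drawing V E pos crv"
    and unbounded: "\<not> bounded (connected_component_set (- drawing_set V E pos crv) z)"
    and outer: "v \<in> V \<Longrightarrow> pos v \<in> frontier (connected_component_set (- drawing_set V E pos crv) z)"
begin

lemma E_sym: "E u v \<Longrightarrow> E v u" and E_irrefl: "\<not> E v v" and E_in: "E u v \<Longrightarrow> u \<in> V \<and> v \<in> V"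
  using graph unfolding simple_graph_def by blast+

lemma pos_eq_iff: "u \<in> V \<Longrightarrow> v \<in> V \<Longrightarrow> pos u = pos v \<longleftrightarrow> u = v"
  using drawing unfolding plane_drawing_def by (auto dest: inj_onD)

lemma edge_arc: "E u v \<Longrightarrow> arc (crv u v)" "E u v \<Longrightarrow> pathstart (crv u v) = pos u"
    "E u v \<Longrightarrow> pathfinish (crv u v) = pos v"
  and edge_commute: "E u v \<Longrightarrow> path_image (crv v u) = path_image (crv u v)"
  using drawing unfolding plane_drawing_def by blast+

lemma vertex_on_edge: "E u v \<Longrightarrow> w \<in> V \<Longrightarrow> pos w \<in> path_image (crv u v) \<Longrightarrow> w = u \<or> w = v"
  using drawing unfolding plane_drawing_def by blast

lemma edges_meet: "E u v \<Longrightarrow> E x y \<Longrightarrow> {u, v} \<noteq> {x, y} \<Longrightarrow>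
    path_image (crv u v) \<inter> path_image (crv x y) \<subseteq> pos ` ({u, v} \<inter> {x, y})"
  using drawing unfolding plane_drawing_def by blast

lemma path_in_V: "successively E xs \<Longrightarrow> length xs \<ge> 2 \<Longrightarrow> set xs \<subseteq> V"
proof (induction xs rule: induct_list012)
  case (3 x y zs)
  then show ?case using E_in[of x y] by (cases zs) auto
qed auto

lemma trace_rev: "successively E xs \<Longrightarrow> trace crv (rev xs) = trace crv xs"
proof (induction xs rule: induct_list012)
  case (3 x y zs)
  have "trace crv (rev (x # y # zs)) = trace crv (rev (y # zs)) \<union> path_image (crv y x)"
    using trace_append[of crv "rev zs" y "[x]"] by simp
  then show ?case using 3 edge_commute by auto
qed auto

lemma trace_in_drawing: "successively E xs \<Longrightarrow> trace crv xs \<subseteq> drawing_set V E pos crv"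
proof (induction xs rule: induct_list012)
  case (3 x y zs)
  then have "path_image (crv x y) \<subseteq> drawing_set V E pos crv"
    unfolding drawing_set_def by (auto 4 4)
  then show ?case using 3 by simp
qed auto

lemma vertex_on_trace:
  assumes "successively E xs" "v \<in> V" "pos v \<in> trace crv xs"
  shows "v \<in> set xs"
  using assms(3)
proof (rule in_traceE)
  fix us x y vs assume xs: "xs = us @ x # y # vs" and p: "pos v \<in> path_image (crv x y)"
  then have "E x y" using assms(1) by (auto simp: successively_append_iff)
  then show ?thesis using vertex_on_edge[OF _ assms(2) p] xs by auto
qed

lemma vertex_in_trace: "successively E xs \<Longrightarrow> length xs \<ge> 2 \<Longrightarrow> v \<in> set xs \<Longrightarrow> pos v \<in> trace crv xs"
proof (induction xs rule: induct_list012)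
  case (3 x y zs)
  have "E x y" using 3(3) by simp
  then have "pos x \<in> path_image (crv x y)" "pos y \<in> path_image (crv x y)"
    using edge_arc[of x y] pathstart_in_path_image pathfinish_in_path_image by metis+
  then show ?case using 3 by (cases zs) auto
qed auto

text \<open>Curves of different edges meet only at common endpoints; the last assumption ensures
  that no edge is shared.\<close>

lemma traces_meet:
  assumes "successively E xs" "successively E ys"
    and "\<And>us x y vs. ys = us @ x # y # vs \<Longrightarrow> \<not> {x, y} \<subseteq> set xs"
  shows "trace crv xs \<inter> trace crv ys \<subseteq> pos ` (set xs \<inter> set ys)"
proof
  fix p assume p: "p \<in> trace crv xs \<inter> trace crv ys"
  obtain us x y vs where 1: "xs = us @ x # y # vs" "p \<in> path_image (crv x y)"
    using p by (auto elim: in_traceE)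
  obtain us' x' y' vs' where 2: "ys = us' @ x' # y' # vs'" "p \<in> path_image (crv x' y')"
    using p by (auto elim: in_traceE)
  have "E x y" "E x' y'" using assms(1,2) 1(1) 2(1) by (auto simp: successively_append_iff)
  moreover have "{x, y} \<noteq> {x', y'}" using assms(3)[OF 2(1)] 1(1) by auto
  ultimately have "p \<in> pos ` ({x, y} \<inter> {x', y'})" using edges_meet 1(2) 2(2) by blast
  then show "p \<in> pos ` (set xs \<inter> set ys)" using 1(1) 2(1) by auto
qed

lemma arc_trace:
  "successively E xs \<Longrightarrow> distinct xs \<Longrightarrow> length xs \<ge> 2 \<Longrightarrow>
     \<exists>g. arc g \<and> pathstart g = pos (hd xs) \<and> pathfinish g = pos (last xs) \<and> path_image g = trace crv xs"
proof (induction xs rule: induct_list012)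
  case (3 x y zs)
  have E: "E x y" using 3(3) by simp
  show ?case
  proof (cases zs)
    case Nil
    then show ?thesis using edge_arc[OF E] by auto
  next
    case (Cons w ws)
    then obtain g where g: "arc g" "pathstart g = pos y" "pathfinish g = pos (last zs)"
        "path_image g = trace crv (y # zs)"
      using 3 by auto
    have "trace crv (y # zs) \<inter> trace crv [x, y] \<subseteq> pos ` (set (y # zs) \<inter> set [x, y])"
    proof (rule traces_meet)
      show "\<not> {x', y'} \<subseteq> set (y # zs)" if "[x, y] = us @ x' # y' # vs" for us x' y' vs
        using that 3(4) by (auto simp: Cons_eq_append_conv)
    qed (use 3 E in auto)
    then have "path_image (crv x y) \<inter> path_image g \<subseteq> {pathstart g}"
      using g 3(4) by auto
    then have "arc (crv x y +++ g)"
      using g edge_arc[OF E] by (intro arc_join) auto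
    then show ?thesis
      using g edge_arc[OF E] Cons by (intro exI[of _ "crv x y +++ g"]) (auto simp: path_image_join)
  qed
qed auto

section \<open>Thetas, cycles and chords in an outerplanar drawing\<close>

lemma vertex_not_inside:
  assumes "closed J" "J \<subseteq> drawing_set V E pos crv" "v \<in> V"
  shows "pos v \<notin> inside J"
  using inside_not_in_frontier[OF assms(1,2) refl unbounded] outer[OF assms(3)] by blast

text \<open>\<open>xs = []\<close> is allowed, so this serves for a chord against a path as well as
  for two paths.\<close>

lemma theta_arcs:
  assumes "distinct (a # xs @ [b])" "distinct (a # ys @ [b])" "set xs \<inter> set ys = {}" "ys \<noteq> []"
    "successively E (a # xs @ [b])" "successively E (a # ys @ [b])"
  shows "trace crv (a # xs @ [b]) \<inter> trace crv (a # ys @ [b]) = {pos a, pos b}"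
proof
  have "trace crv (a # xs @ [b]) \<inter> trace crv (a # ys @ [b]) \<subseteq> pos ` (set (a # xs @ [b]) \<inter> set (a # ys @ [b]))"
  proof (rule traces_meet)
    show "\<not> {x, y} \<subseteq> set (a # xs @ [b])" if "a # ys @ [b] = us @ x # y # vs" for us x y vs
    proof -
      have "{x, y} \<subseteq> set (a # ys @ [b])" unfolding that by auto
      then show ?thesis using consecutive_not_ends[OF that assms(2,4)] assms(3) by auto
    qed
  qed (use assms in auto)
  then show "trace crv (a # xs @ [b]) \<inter> trace crv (a # ys @ [b]) \<subseteq> {pos a, pos b}"
    using assms by auto
  show "{pos a, pos b} \<subseteq> trace crv (a # xs @ [b]) \<inter> trace crv (a # ys @ [b])"
    using assms vertex_in_trace[of "a # xs @ [b]"] vertex_in_trace[of "a # ys @ [b]"] by auto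
qed

text \<open>By \<open>theta_middle_arc\<close> one path runs inside the circle of the other two. An
  interior vertex on it would be cut off from the outer region, so the middle path is a single edge,
  and this can only be the one through \<open>zs\<close>.\<close>

lemma theta_middle_is_edge:
  assumes xs: "distinct (a # xs @ [b])" "xs \<noteq> []" "successively E (a # xs @ [b])"
    and ys: "distinct (a # ys @ [b])" "ys \<noteq> []" "successively E (a # ys @ [b])"
    and zs: "distinct (a # zs @ [b])" "successively E (a # zs @ [b])"
    and disj: "set xs \<inter> set ys = {}" "set xs \<inter> set zs = {}" "set ys \<inter> set zs = {}"
  shows "zs = []" "trace crv (a # zs @ [b]) - {pos a, pos b} \<subseteq> inside (trace crv (a # xs @ [b]) \<union> trace crv (a # ys @ [b]))"
proof -
  obtain c1 where c1: "arc c1" "pathstart c1 = pos a" "pathfinish c1 = pos b" "path_image c1 = trace crv (a # xs @ [b])"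
    using arc_trace[OF xs(3,1)] by auto
  obtain c2 where c2: "arc c2" "pathstart c2 = pos a" "pathfinish c2 = pos b" "path_image c2 = trace crv (a # ys @ [b])"
    using arc_trace[OF ys(3,1)] by auto
  obtain c3 where c3: "arc c3" "pathstart c3 = pos a" "pathfinish c3 = pos b" "path_image c3 = trace crv (a # zs @ [b])"
    using arc_trace[OF zs(2,1)] by auto
  have int: "path_image c1 \<inter> path_image c2 = {pos a, pos b}" "path_image c1 \<inter> path_image c3 = {pos a, pos b}"
    "path_image c2 \<inter> path_image c3 = {pos a, pos b}"
    using theta_arcs[of a xs b ys] theta_arcs[of a zs b xs] theta_arcs[of a zs b ys] assms c1(4) c2(4) c3(4)
    by (auto simp: Int_commute)
  have not_inside: "\<not> trace crv (a # us @ [b]) - {pos a, pos b} \<subseteq> inside (path_image c \<union> path_image c')"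
    if us: "us \<noteq> []" "distinct (a # us @ [b])" "successively E (a # us @ [b])"
      and c: "arc c" "arc c'" "path_image c = trace crv vs" "path_image c' = trace crv ws"
        "successively E vs" "successively E ws" for us vs ws c c'
  proof -
    have "pos (hd us) \<in> trace crv (a # us @ [b])" and V: "set (a # us @ [b]) \<subseteq> V"
      using us vertex_in_trace[of "a # us @ [b]" "hd us"] path_in_V[of "a # us @ [b]"] by auto
    moreover have "hd us \<in> set us" using us(1) by simp
    then have "pos (hd us) \<notin> {pos a, pos b}" using us(2) V by (auto simp: pos_eq_iff)
    moreover have "closed (path_image c \<union> path_image c')" using c closed_arc_image by blast
    then have "pos (hd us) \<notin> inside (path_image c \<union> path_image c')"
      using \<open>hd us \<in> set us\<close> V c trace_in_drawing[of vs] trace_in_drawing[of ws]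
      by (intro vertex_not_inside) auto
    ultimately show ?thesis by blast
  qed
  have "path_image c3 - {pos a, pos b} \<subseteq> inside (path_image c1 \<union> path_image c2)"
    using theta_middle_arc[OF c1(1-3) c2(1-3) c3(1-3) int]
      not_inside[OF xs(2,1,3) c2(1) c3(1) c2(4) c3(4) ys(3) zs(2)]
      not_inside[OF ys(2,1,3) c1(1) c3(1) c1(4) c3(4) xs(3) zs(2)] c1(4) c2(4) by metis
  then show "trace crv (a # zs @ [b]) - {pos a, pos b} \<subseteq> inside (trace crv (a # xs @ [b]) \<union> trace crv (a # ys @ [b]))"
    and "zs = []"
    using not_inside[OF _ zs(1,2) c1(1) c2(1) c1(4) c2(4) xs(3) ys(3)] c1(4) c2(4) c3(4) by auto
qed

text \<open>The ends of the chord split the cycle into two paths with interior vertices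
  \<open>c\<close> and \<open>d\<close>, and the chord is the third path of a theta. The second path
  is reversed so that it also runs from \<open>a\<close> to \<open>b\<close>.\<close>

lemma chord_inside:
  assumes cyc: "is_cycle E (a # A @ c # C @ b # B @ d # D)" and ab: "E a b"
  shows "path_image (crv a b) - {pos a, pos b} \<subseteq> inside (trace crv (a # A @ c # C @ b # B @ d # D @ [a]))"
proof -
  let ?xs = "A @ c # C" and ?ys = "rev D @ d # rev B"
  have suc: "successively E (a # ?xs @ [b])" "successively E (b # (B @ d # D) @ [a])"
    using is_cycle_splitD[of E a ?xs b "B @ d # D"] cyc by simp_all
  have "successively (\<lambda>x y. E y x) (b # (B @ d # D) @ [a])"
    using suc(2) by (rule successively_mono) (auto intro: E_sym)
  then have ys: "successively E (a # ?ys @ [b])"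
    using successively_rev[of E "b # (B @ d # D) @ [a]"] by simp
  have "trace crv (a # [] @ [b]) - {pos a, pos b} \<subseteq> inside (trace crv (a # ?xs @ [b]) \<union> trace crv (a # ?ys @ [b]))"
    using cyc ab suc(1) ys by (intro theta_middle_is_edge(2)) (auto simp: is_cycle_def)
  moreover have "trace crv (a # ?ys @ [b]) = trace crv (b # (B @ d # D) @ [a])"
    using trace_rev[OF suc(2)] by simp
  moreover have "trace crv ((a # A @ c # C) @ b # (B @ d # D @ [a])) =
      trace crv (a # ?xs @ [b]) \<union> trace crv (b # (B @ d # D) @ [a])"
    by (subst trace_append) simp
  ultimately show ?thesis by simp
qed

text \<open>Both chords run inside the Jordan curve of the cycle. The chord \<open>a b\<close> cuts
  this inside in two, and the chord \<open>c d\<close>, which avoids it, stays in one part; but the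
  closure of either part misses one of \<open>c\<close> and \<open>d\<close>.\<close>

lemma no_crossing_chords:
  assumes cyc: "is_cycle E (a # A @ c # C @ b # B @ d # D)"
  shows "\<not> (E a b \<and> E c d)"
proof
  assume E: "E a b \<and> E c d"
  define xs where "xs = A @ c # C"
  define ys where "ys = B @ d # D"
  let ?J = "trace crv (a # xs @ [b]) \<union> trace crv (b # ys @ [a])"
  have ab: "path_image (crv a b) - {pos a, pos b} \<subseteq> inside ?J"
    using chord_inside[OF cyc] E trace_append[of crv "a # xs" b "ys @ [a]"] by (simp add: xs_def ys_def)
  \<comment> \<open>Rotation makes \<open>chord_inside\<close> applicable to the second chord; the
    traced curve stays the same.\<close>
  have "is_cycle E (c # C @ b # B @ d # D @ a # A)"
    using cyc is_cycle_rotate[of E "a # A" "c # C @ b # B @ d # D"] by simp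
  then have "path_image (crv c d) - {pos c, pos d} \<subseteq> inside (trace crv (c # C @ b # B @ d # D @ a # A @ [c]))"
    using chord_inside E by blast
  moreover have "trace crv (c # C @ b # B @ d # D @ a # A @ [c]) = ?J"
    using trace_append[of crv "c # C" b "B @ d # D @ a # A @ [c]"]
      trace_append[of crv "b # B @ d # D" a "A @ [c]"] trace_append[of crv "a # A" c "C @ [b]"]
    by (auto simp: xs_def ys_def)
  ultimately have cd: "path_image (crv c d) - {pos c, pos d} \<subseteq> inside ?J" by simp
  have dist: "distinct (a # xs @ b # ys)" using cyc by (simp add: is_cycle_def xs_def ys_def)
  have suc: "successively E (a # xs @ [b])" "successively E (b # ys @ [a])"
    using is_cycle_splitD[of E a xs b ys] cyc by (simp_all add: xs_def ys_def)
  have "successively (\<lambda>x y. E y x) (b # ys @ [a])"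
    using suc(2) by (rule successively_mono) (auto intro: E_sym)
  then have suc': "successively E (a # rev ys @ [b])"
    using successively_rev[of E "b # ys @ [a]"] by simp
  have tr: "trace crv (a # rev ys @ [b]) = trace crv (b # ys @ [a])"
    using trace_rev[OF suc(2)] by simp
  have V: "a \<in> V" "b \<in> V" "c \<in> V" "d \<in> V" using E E_in by auto
  have ne: "a \<noteq> b" "a \<noteq> c" "a \<noteq> d" "b \<noteq> c" "b \<noteq> d" "c \<noteq> d" "c \<in> set xs" "d \<in> set ys"
    using dist by (auto simp: xs_def ys_def)
  have nonempty: "xs \<noteq> []" "ys \<noteq> []" by (auto simp: xs_def ys_def)
  obtain g where g: "arc g" "pathstart g = pos a" "pathfinish g = pos b" "path_image g = trace crv (a # xs @ [b])"
    using arc_trace[OF suc(1)] dist by auto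
  obtain h where h: "arc h" "pathstart h = pos a" "pathfinish h = pos b" "path_image h = trace crv (b # ys @ [a])"
    using arc_trace[OF suc'] dist tr by auto
  note k = edge_arc[of a b]
  have int: "path_image g \<inter> path_image h = {pos a, pos b}"
    "path_image g \<inter> path_image (crv a b) = {pos a, pos b}" "path_image h \<inter> path_image (crv a b) = {pos a, pos b}"
    using theta_arcs[of a xs b "rev ys"] theta_arcs[of a "[]" b xs] theta_arcs[of a "[]" b "rev ys"]
      nonempty dist E suc suc' tr g(4) h(4) by (simp_all add: Int_commute)
  have "path_image (crv a b) - {pos a, pos b} \<noteq> {}"
    using nonempty_simple_path_endless[of "crv a b"] k E arc_imp_simple_path by metis
  then have meets: "path_image (crv a b) \<inter> inside (path_image g \<union> path_image h) \<noteq> {}"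
    using ab g(4) h(4) by auto
  let ?I = "inside (path_image g \<union> path_image (crv a b))" and ?O = "inside (path_image h \<union> path_image (crv a b))"
  \<comment> \<open>\<open>?I\<close> is bordered by the chord \<open>a b\<close> and the path
    through \<open>c\<close>, \<open>?O\<close> by the chord and the path through
    \<open>d\<close>.\<close>
  obtain dis: "?I \<inter> ?O = {}" and un: "?I \<union> ?O \<union> (path_image (crv a b) - {pos a, pos b}) = inside ?J"
    using split_inside_simple_closed_curve[of g "pos a" "pos b" h "crv a b"] g h k E V ne int meets
    by (auto simp: arc_imp_simple_path pos_eq_iff)
  have cl: "closed (path_image g \<union> path_image (crv a b))" "closed (path_image h \<union> path_image (crv a b))"
    using g(1) h(1) k(1) E by (auto simp: closed_arc_image)
  have "path_image (crv c d) \<inter> path_image (crv a b) = {}"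
    using edges_meet[of c d a b] E ne by auto
  then have cover: "path_image (crv c d) - {pos c, pos d} \<subseteq> ?I \<union> ?O"
    using cd un by blast
  have "connected (path_image (crv c d) - {pos c, pos d})"
    using connected_simple_path_endless[of "crv c d"] edge_arc[of c d] E arc_imp_simple_path by metis
  then have "path_image (crv c d) - {pos c, pos d} \<subseteq> ?I \<or> path_image (crv c d) - {pos c, pos d} \<subseteq> ?O"
    using connectedD[of _ ?I ?O] cover dis open_inside[OF cl(1)] open_inside[OF cl(2)] by blast
  moreover have closures: "pos c \<in> closure (path_image (crv c d) - {pos c, pos d})"
    "pos d \<in> closure (path_image (crv c d) - {pos c, pos d})"
    using pathstart_pathfinish_in_closure_endless[of "crv c d"] edge_arc[of c d] E by auto
  \<comment> \<open>The end chosen is the one that does not lie on the border of the part containing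
    the chord \<open>c d\<close>.\<close>
  ultimately have "pos d \<in> closure ?I \<or> pos c \<in> closure ?O" using closure_mono by blast
  then have "pos d \<in> path_image g \<union> path_image (crv a b) \<union> ?I \<or> pos c \<in> path_image h \<union> path_image (crv a b) \<union> ?O"
    using closure_inside_subset[OF cl(1)] closure_inside_subset[OF cl(2)] by blast
  moreover have "pos c \<in> ?J" "pos d \<in> ?J"
    using vertex_in_trace[OF suc(1), of c] vertex_in_trace[OF suc(2), of d] ne by auto
  then have "pos c \<notin> inside ?J" "pos d \<notin> inside ?J" using inside_no_overlap[of ?J] by blast+
  then have "pos d \<notin> ?I" "pos c \<notin> ?O" using un by blast+
  moreover have "pos d \<notin> path_image (crv a b)" "pos c \<notin> path_image (crv a b)"
    using vertex_on_edge[of a b] E V ne by auto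
  moreover have "pos d \<notin> path_image g" "pos c \<notin> path_image h"
    using vertex_on_trace[OF suc(1), of d] vertex_on_trace[OF suc(2), of c] V g(4) h(4) dist ne by auto
  ultimately show False by blast
qed

theorem has_noncrossing_order: "\<exists>xs. distinct xs \<and> set xs = V \<and> noncrossing E xs"
proof (rule noncrossing_order)
  show False
    if "xs \<noteq> []" "ys \<noteq> []" "zs \<noteq> []" "distinct (a # b # xs @ ys @ zs)"
      "successively E (a # xs @ [b])" "successively E (a # ys @ [b])" "successively E (a # zs @ [b])" for a b xs ys zs
    using theta_middle_is_edge(1)[of a xs b ys zs] that by auto
  show "finite V" using graph by (simp add: simple_graph_def)
qed (fact E_sym E_irrefl no_crossing_chords)+

end

section \<open>The hat guessing number of outerplanar graphs\<close>

theorem theorem1p3: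
  fixes V :: "'a set" and E :: "'a \<Rightarrow> 'a \<Rightarrow> bool"
  assumes "outerplanar V E"
  shows "\<forall>q. hat_winning V E q \<longrightarrow> q \<le> 40"
proof (intro allI impI)
  fix q assume win: "hat_winning V E q"
  obtain pos crv z where "outerplanar_drawing V E pos crv z"
    using assms unfolding outerplanar_def outerplanar_drawing_def by blast
  then interpret outerplanar_drawing V E pos crv z .
  obtain xs where xs: "distinct xs" "set xs = V" "noncrossing E xs"
    using has_noncrossing_order by blast
  show "q \<le> 40"
  proof (rule ccontr)
    assume "\<not> q \<le> 40"
    then have "adversary_wins E q (set xs) (\<lambda>_. 1)"
      using E_irrefl E_sym xs by (intro adversary_wins_noncrossing) auto
    then show False
      using not_hat_winning_if_adversary_wins[of E q V] win xs(2) E_in by blast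
  qed
qed

end
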